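(* Let $Z$ be a separable Banach space, and $\mathcal{Z}$ its dual. Let $k\ge 2$ be an integer, $p>2$, $U:[0,1]^2\to\mathcal{Z}$ an $L^p_{\mathcal{Z}}$-kernel, and $\gamma\in(1/p,1/2)$. Let $X=(X_1,\dots,X_k)$ be a uniform random vector in $[0,1]^k$. Then with probability at least $1-4k^{1-\gamma p}$, $$\|\mathcal{U}_X\|_\square-\|U\|_\square\ge -\left(\|U\|_\square+6\sqrt{2(\gamma p-1)}\,(\|U\|_1+2\|U\|_p)\right)k^{-1/2+\gamma}\sqrt{\ln k}.$$
   Context: Let $Z$ be a separable real Banach space with dual $\mathcal{Z}$ and pairing $\langle f,w\rangle$ for $f\in Z$, $w\in\mathcal{Z}$. A symmetric function $W:[0,1]^2\to\mathcal{Z}$ is an $L^p_{\mathcal{Z}}$-kernel if it is weak-* measurable and $(x,y)\mapsto\|W(x,y)\|_{\mathcal{Z}}$ lies in $L^p([0,1]^2)$. Put $\|W\|_r=\left(\int_{[0,1]^2}\|W(x,y)\|_{\mathcal{Z}}^r\right)^{1/r}$ for $r\ge 1$. For real-valued $V\in L^1([0,1]^2)$, $\|V\|_\square=\sup_{S,T\subseteq[0,1]}\left|\int_{S\times T}V\right|$ (supremum over measurable sets). For an $L^p_{\mathcal{Z}}$-kernel $W$ (or a $\mathcal{Z}$-valued step function), $\|W\|_\square=\sup_{f\in Z,\ \|f\|_Z=1}\|\langle f,W\rangle\|_\square$, where $\langle f,W\rangle(x,y)=\langle f,W(x,y)\rangle$. For $X=(X_1,\dots,X_k)$ with $X_1,\dots,X_k$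 i.i.d. uniform on $[0,1]$, $\mathcal{U}_X$ is the $\mathcal{Z}$-valued step function on $[0,1]^2$ with uniform steps of length $1/k$ in each variable, taking on $[(i-1)/k,i/k]\times[(j-1)/k,j/k]$ the value $U(X_i,X_j)$ if $i\ne j$ and $0$ if $i=j$. *)

theory Defs
  imports "HOL-Probability.Probability"
begin

text \<open>
  The dual of the Banach space \<open>'z\<close> is the type \<open>'z \<Rightarrow>\<^sub>L real\<close>, whose norm is the operator norm;
  the pairing of \<open>f :: 'z\<close> with \<open>w\<close> is \<open>blinfun_apply w f\<close>.  Functions on the unit square are total
  functions on \<open>real \<times> real\<close> whose values outside the square are irrelevant.
  Measurability on the square means Lebesgue measurability, so for random variables \<open>X\<^sub>1, X\<^sub>2\<close> on a
  probability space \<open>M\<close> the value \<open>U (X\<^sub>1, X\<^sub>2)\<close> is weak-* measurable only with respect to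
  \<open>completion M\<close>; probabilities of events depending on such values are taken there.
\<close>

abbreviation unit_square :: "(real \<times> real) set" where
  "unit_square \<equiv> {0..1} \<times> {0..1}"

definition weak_star_measurable ::
  "(real \<times> real \<Rightarrow> ('z::real_normed_vector \<Rightarrow>\<^sub>L real)) \<Rightarrow> bool" where
  "weak_star_measurable W \<longleftrightarrow>
     (\<forall>f. (\<lambda>z. blinfun_apply (W z) f) \<in> borel_measurable (lebesgue_on unit_square))"

definition Lp_kernel ::
  "real \<Rightarrow> (real \<times> real \<Rightarrow> ('z::real_normed_vector \<Rightarrow>\<^sub>L real)) \<Rightarrow> bool" where
  "Lp_kernel p W \<longleftrightarrow>
     (\<forall>x\<in>{0..1}. \<forall>y\<in>{0..1}. W (x, y) = W (y, x)) \<and>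
     weak_star_measurable W \<and>
     (\<lambda>z. norm (W z)) \<in> borel_measurable (lebesgue_on unit_square) \<and>
     integrable (lebesgue_on unit_square) (\<lambda>z. norm (W z) powr p)"

definition Lr_norm ::
  "real \<Rightarrow> (real \<times> real \<Rightarrow> ('z::real_normed_vector \<Rightarrow>\<^sub>L real)) \<Rightarrow> real" where
  "Lr_norm r W = (LINT z|lebesgue_on unit_square. norm (W z) powr r) powr (1 / r)"

definition real_cut_norm :: "(real \<times> real \<Rightarrow> real) \<Rightarrow> real" where
  "real_cut_norm V =
     (SUP (S, T)\<in>{(S, T). S \<in> sets lebesgue \<and> S \<subseteq> {0..1} \<and> T \<in> sets lebesgue \<and> T \<subseteq> {0..1}}.
        \<bar>LINT z:S \<times> T|lebesgue. V z\<bar>)"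

text \<open>
  The supremum is over nonnegative numbers, so inserting 0 changes it only when \<open>'z\<close> is the zero
  space, which has no unit vector: the cut norm is then 0 instead of an unspecified real number.
\<close>

definition cut_norm :: "(real \<times> real \<Rightarrow> ('z::real_normed_vector \<Rightarrow>\<^sub>L real)) \<Rightarrow> real" where
  "cut_norm W =
     Sup (insert 0 ((\<lambda>f. real_cut_norm (\<lambda>z. blinfun_apply (W z) f)) ` {f. norm f = 1}))"

text \<open>
  The steps are taken half-open so that they do not overlap; this only affects values on a null set.
\<close>

definition sampled_step ::
  "nat \<Rightarrow> (real \<times> real \<Rightarrow> ('z::real_normed_vector \<Rightarrow>\<^sub>L real)) \<Rightarrow> (nat \<Rightarrow> real)
     \<Rightarrow> real \<times> real \<Rightarrow> ('z \<Rightarrow>\<^sub>L real)" where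
  "sampled_step k U x z =
     (\<Sum>i=1..k. \<Sum>j=1..k.
        indicator ({(real i - 1) / real k..<real i / real k} \<times> {(real j - 1) / real k..<real j / real k}) z
          *\<^sub>R (if i = j then 0 else U (x i, x j)))"

end

theory Submission
  imports Defs
begin

text \<open>
  Fix a unit vector \<open>f\<close> and sets \<open>S\<close>, \<open>T\<close> that almost attain the cut norm of \<open>U\<close>.  Restricting the
  sample to the indices with \<open>X\<^sub>i \<in> S\<close> and \<open>X\<^sub>j \<in> T\<close> bounds the cut norm of the sampled step function
  below by the U-statistic \<open>k\<^sup>-\<^sup>2 \<Sum>\<^sub>i\<^sub>\<noteq>\<^sub>j H (X\<^sub>i, X\<^sub>j)\<close> of the single real function
  \<open>H = \<plusminus> 1\<^sub>S\<^sub>\<times>\<^sub>T \<langle>f, U\<rangle>\<close>, so no supremum has to be controlled.  Truncate \<open>H\<close> at the level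
  \<open>k\<^sup>\<gamma> \<parallel>U\<parallel>\<^sub>p\<close>: the truncated part satisfies the bounded differences inequality, and the rest has
  first moment at most \<open>k\<^sup>\<gamma>\<^sup>-\<^sup>\<gamma>\<^sup>p \<parallel>U\<parallel>\<^sub>p\<close>, so Markov's inequality suffices for it.  Each of the two
  fails with probability at most \<open>k\<^sup>1\<^sup>-\<^sup>\<gamma>\<^sup>p\<close>.
\<close>

subsection \<open>The bounded differences inequality and U-statistics\<close>

text \<open>The tail bound obtained is 2 k^(1 - \<gamma> p). The factor 4 of the claim serves to set
  aside the case 4 k^(1 - \<gamma> p) \<ge> 1, where the claimed lower bound is at most 0. Otherwise
  (\<gamma> p - 1) ln k > ln 4, so that r = sqrt (2 (\<gamma> p - 1) ln k) is at least 1. This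
  absorbs the losses that carry no logarithm into the error term: the missing diagonal (k (k - 1)
  pairs against k^2), the relative slack 1/k in the choice of f, S and T, and the truncation. The
  other obstacle is measurability. The kernel and the sets S, T are only Lebesgue measurable, while
  the variables are Borel. The pairing is therefore replaced by a Borel function that agrees with it
  almost everywhere on the square, and S, T by Borel subsets of the same measure. A pair of sample
  points with distinct indices almost surely avoids the exceptional null set. The final event has a
  meaningful probability only because the cut norm of the sample is measurable for the completion,
  and this is where separability enters.\<close>

text \<open>Hoeffding's lemma is tensorised one coordinate at a time. With the new coordinate fixed
  at \<open>y\<close>, split \<open>f - E\<close> into the deviation of \<open>f\<close> from its
  mean \<open>g y\<close> over the old coordinates and the deviation of \<open>g y\<close> from
  \<open>E\<close>. The induction hypothesis bounds the exponential moment of the former uniformly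
  in \<open>y\<close>. Averaging preserves the difference bound, so \<open>g\<close> oscillates by
  at most \<open>c i\<close> and Hoeffding's lemma handles the latter.\<close>

lemma nn_integral_exp_bounded_differences:
  fixes f :: "('i \<Rightarrow> 'b) \<Rightarrow> real"
  assumes M: "\<And>i. prob_space (M i)" and I: "finite I" and l: "l > 0"
    and f: "f \<in> borel_measurable (PiM I M)"
    and bound: "\<And>x. x \<in> space (PiM I M) \<Longrightarrow> \<bar>f x\<bar> \<le> B"
    and diff: "\<And>i x y. i \<in> I \<Longrightarrow> x \<in> space (PiM I M) \<Longrightarrow> y \<in> space (M i) \<Longrightarrow>
      \<bar>f (x(i := y)) - f x\<bar> \<le> c i"
  shows "(\<integral>\<^sup>+x. ennreal (exp (l * (f x - (\<integral>x. f x \<partial>PiM I M)))) \<partial>PiM I M)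
    \<le> ennreal (exp (l\<^sup>2 * (\<Sum>i\<in>I. (c i)\<^sup>2) / 8))"
  using I f bound diff
proof (induction I arbitrary: f)
  case empty
  interpret product_prob_space M by (intro product_prob_spaceI M)
  show ?case
    by (simp add: PiM_empty nn_integral_count_space_finite lebesgue_integral_count_space_finite)
next
  case (insert i I)
  interpret product_prob_space M by (intro product_prob_spaceI M)
  interpret PI: prob_space "PiM I M" by (intro prob_space_PiM M)
  interpret PI': prob_space "PiM (insert i I) M" by (intro prob_space_PiM M)
  interpret Q: prob_space "M i" by (rule M)
  interpret PQ: pair_prob_space "PiM I M" "M i" ..
  note [measurable] = insert.prems(1) measurable_add_dim[of i I M]
  have upd: "x(i := y) \<in> space (PiM (insert i I) M)"
    if "x \<in> space (PiM I M)" "y \<in> space (M i)" for x y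
    using that by (auto simp: space_PiM PiE_iff extensional_def)
  have F [measurable]: "(\<lambda>(x, y). f (x(i := y))) \<in> borel_measurable (PiM I M \<Otimes>\<^sub>M M i)"
    using measurable_compose[OF measurable_add_dim[of i I M] insert.prems(1)]
    by (simp add: case_prod_unfold)
  have B: "\<bar>f (x(i := y))\<bar> \<le> B" if "x \<in> space (PiM I M)" "y \<in> space (M i)" for x y
    using insert.prems(2) upd that by blast
  have Fx: "integrable (PiM I M) (\<lambda>x. f (x(i := y)))" if y: "y \<in> space (M i)" for y
    by (rule PI.integrable_const_bound[of _ B]) (use B y in \<open>auto intro: AE_I2\<close>)
  define g where "g y = (\<integral>x. f (x(i := y)) \<partial>PiM I M)" for y
  define E where "E = (\<integral>x. f x \<partial>PiM (insert i I) M)"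
  have [measurable]: "g \<in> borel_measurable (M i)"
    unfolding g_def by (rule PI.borel_measurable_lebesgue_integral) (use F in measurable)
  have "E = (\<integral>x. \<integral>y. f (x(i := y)) \<partial>M i \<partial>PiM I M)"
    unfolding E_def
    by (intro product_integral_insert insert.hyps PI'.integrable_const_bound[of _ B])
       (use insert.prems in \<open>auto intro: AE_I2\<close>)
  also have "\<dots> = (\<integral>y. g y \<partial>M i)"
    unfolding g_def
    by (rule PQ.Fubini_integral[symmetric], rule PQ.P.integrable_const_bound[of _ B])
       (use B in \<open>auto intro!: AE_I2 simp: space_pair_measure\<close>)
  finally have E: "E = (\<integral>y. g y \<partial>M i)" .
  have g_diff: "g y \<le> g y' + c i" if "y \<in> space (M i)" "y' \<in> space (M i)" for y y'
  proof -
    have "g y \<le> (\<integral>x. f (x(i := y')) + c i \<partial>PiM I M)"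
      unfolding g_def
    proof (intro integral_mono Bochner_Integration.integrable_add Fx that PI.integrable_const)
      fix x assume x: "x \<in> space (PiM I M)"
      show "f (x(i := y)) \<le> f (x(i := y')) + c i"
        using insert.prems(3)[OF insertI1 upd[OF x that(2)] that(1)] unfolding fun_upd_upd by linarith
    qed
    also have "\<dots> = g y' + c i"
      unfolding g_def using Fx[OF that(2)] by (simp add: PI.prob_space)
    finally show ?thesis .
  qed
  obtain y0 where y0: "y0 \<in> space (M i)" using prob_space.not_empty[OF M] by blast
  \<comment> \<open>Anchoring the range at the infimum puts \<open>g\<close> into an interval of
    length \<open>c i\<close>. An interval centred at one value of \<open>g\<close> would have
    length \<open>2 * c i\<close> and lose a factor 4 in the exponent.\<close>
  define a where "a = (INF y\<in>space (M i). g y)"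
  have bdd: "bdd_below (g ` space (M i))"
    by (rule bdd_belowI[of _ "g y0 - c i"]) (use g_diff[OF y0] in \<open>force simp: algebra_simps\<close>)
  have ga: "g y \<in> {a..a + c i}" if y: "y \<in> space (M i)" for y
  proof -
    have "a \<le> g y" unfolding a_def by (rule cINF_lower[OF bdd y])
    moreover have "g y - c i \<le> a" unfolding a_def
      by (rule cINF_greatest) (use prob_space.not_empty[OF M] g_diff[OF y] in \<open>auto simp: algebra_simps\<close>)
    ultimately show ?thesis by auto
  qed
  interpret H: interval_bounded_random_variable "M i" g a "a + c i"
    by standard (use ga in \<open>auto intro: AE_I2\<close>)
  have "(\<integral>\<^sup>+x. ennreal (exp (l * (f x - E))) \<partial>PiM (insert i I) M)
      = (\<integral>\<^sup>+y. \<integral>\<^sup>+x. ennreal (exp (l * (f (x(i := y)) - E))) \<partial>PiM I M \<partial>M i)"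
    by (rule product_nn_integral_insert_rev) (use insert.hyps in measurable)
  also have "\<dots> = (\<integral>\<^sup>+y. ennreal (exp (l * (g y - E))) *
      (\<integral>\<^sup>+x. ennreal (exp (l * (f (x(i := y)) - g y))) \<partial>PiM I M) \<partial>M i)"
  proof (rule nn_integral_cong)
    fix y assume y[measurable]: "y \<in> space (M i)"
    have [measurable]: "(\<lambda>x. f (x(i := y))) \<in> borel_measurable (PiM I M)"
      using Fx[OF y] by simp
    show "(\<integral>\<^sup>+x. ennreal (exp (l * (f (x(i := y)) - E))) \<partial>PiM I M)
      = ennreal (exp (l * (g y - E))) * (\<integral>\<^sup>+x. ennreal (exp (l * (f (x(i := y)) - g y))) \<partial>PiM I M)"
      by (subst nn_integral_cmult[symmetric])
         (auto simp: ennreal_mult[symmetric] exp_add[symmetric] algebra_simps)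
  qed
  also have "\<dots> \<le> (\<integral>\<^sup>+y. ennreal (exp (l * (g y - E))) *
      ennreal (exp (l\<^sup>2 * (\<Sum>i\<in>I. (c i)\<^sup>2) / 8)) \<partial>M i)"
  proof (intro nn_integral_mono mult_left_mono)
    fix y assume y: "y \<in> space (M i)"
    show "(\<integral>\<^sup>+x. ennreal (exp (l * (f (x(i := y)) - g y))) \<partial>PiM I M)
      \<le> ennreal (exp (l\<^sup>2 * (\<Sum>i\<in>I. (c i)\<^sup>2) / 8))"
      unfolding g_def
    proof (rule insert.IH)
      show "(\<lambda>x. f (x(i := y))) \<in> borel_measurable (PiM I M)" using Fx[OF y] by simp
      show "\<bar>f (x(i := y))\<bar> \<le> B" if "x \<in> space (PiM I M)" for x
        by (rule B[OF that y])
      fix j x z assume j: "j \<in> I" and x: "x \<in> space (PiM I M)" and z: "z \<in> space (M j)"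
      have eq: "x(j := z, i := y) = x(i := y, j := z)" using j insert.hyps by (auto intro: fun_upd_twist)
      show "\<bar>f (x(j := z, i := y)) - f (x(i := y))\<bar> \<le> c j"
        unfolding eq by (rule insert.prems(3)[OF insertI2[OF j] upd[OF x y] z])
    qed
  qed simp
  also have "\<dots> = (\<integral>\<^sup>+y. ennreal (exp (l * (g y - E))) \<partial>M i) *
      ennreal (exp (l\<^sup>2 * (\<Sum>i\<in>I. (c i)\<^sup>2) / 8))"
    by (rule nn_integral_multc) simp
  also have "\<dots> \<le> ennreal (exp (l\<^sup>2 * (c i)\<^sup>2 / 8)) * ennreal (exp (l\<^sup>2 * (\<Sum>i\<in>I. (c i)\<^sup>2) / 8))"
    using H.Hoeffdings_lemma_nn_integral[OF l] by (intro mult_right_mono) (simp_all add: E)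
  also have "\<dots> = ennreal (exp (l\<^sup>2 * (\<Sum>i\<in>insert i I. (c i)\<^sup>2) / 8))"
    using insert.hyps
    by (simp add: ennreal_mult[symmetric] exp_add[symmetric] add_divide_distrib distrib_left)
  finally show ?case unfolding E_def .
qed


lemma bounded_differences_lower_tail:
  fixes f :: "('i \<Rightarrow> 'b) \<Rightarrow> real"
  assumes M: "\<And>i. prob_space (M i)" and I: "finite I"
    and f: "f \<in> borel_measurable (PiM I M)"
    and bound: "\<And>x. x \<in> space (PiM I M) \<Longrightarrow> \<bar>f x\<bar> \<le> B"
    and diff: "\<And>i x y. i \<in> I \<Longrightarrow> x \<in> space (PiM I M) \<Longrightarrow> y \<in> space (M i) \<Longrightarrow>
      \<bar>f (x(i := y)) - f x\<bar> \<le> c i"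
    and t: "t > 0" and c: "(\<Sum>i\<in>I. (c i)\<^sup>2) > 0"
  shows "measure (PiM I M) {x \<in> space (PiM I M). f x \<le> (\<integral>x. f x \<partial>PiM I M) - t}
    \<le> exp (- 2 * t\<^sup>2 / (\<Sum>i\<in>I. (c i)\<^sup>2))"
proof -
  interpret P: prob_space "PiM I M" by (intro prob_space_PiM M)
  define d where "d = (\<Sum>i\<in>I. (c i)\<^sup>2)"
  \<comment> \<open>This is the minimiser of \<open>- l * t + l^2 * d / 8\<close>, with minimum
    \<open>- 2 * t^2 / d\<close>. The exponential moment bound is applied to \<open>- f\<close>,
    which has the same differences.\<close>
  define l where "l = 4 * t / d"
  have d: "d > 0" and l: "l > 0" using t c by (auto simp: d_def l_def)
  define E where "E = (\<integral>x. f x \<partial>PiM I M)"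
  note [measurable] = f
  have "ennreal (P.prob {x \<in> space (PiM I M). f x \<le> E - t})
      = emeasure (PiM I M) {x \<in> space (PiM I M). E - f x \<ge> t}"
    unfolding P.emeasure_eq_measure[symmetric] by (rule arg_cong[where f = "emeasure _"]) auto
  also have "\<dots> \<le> ennreal (exp (- l * t)) *
      (\<integral>\<^sup>+x\<in>space (PiM I M). exp (l * (E - f x)) \<partial>PiM I M)"
    by (intro Chernoff_ineq_nn_integral_ge l) auto
  also have "(\<integral>\<^sup>+x\<in>space (PiM I M). exp (l * (E - f x)) \<partial>PiM I M)
      = (\<integral>\<^sup>+x. ennreal (exp (l * (- f x - (\<integral>x. - f x \<partial>PiM I M)))) \<partial>PiM I M)"
    by (intro nn_integral_cong) (simp add: E_def)
  also have "ennreal (exp (- l * t)) * \<dots> \<le> ennreal (exp (- l * t)) * ennreal (exp (l\<^sup>2 * d / 8))"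
    unfolding d_def
    by (intro mult_left_mono nn_integral_exp_bounded_differences[where B = B] M I l)
       (use bound diff in \<open>auto simp: abs_minus_commute\<close>)
  also have "\<dots> = ennreal (exp (- 2 * t\<^sup>2 / d))"
    using d by (simp add: ennreal_mult[symmetric] exp_add[symmetric] l_def power2_eq_square field_simps)
  finally show ?thesis
    by (subst (asm) ennreal_le_iff) (simp_all add: d_def E_def)
qed

section \<open>Laws of pairs and lower tails of U-statistics\<close>

lemma (in prob_space) indep_vars_distr_pair:
  assumes X: "indep_vars N X I" and "i \<in> I" "j \<in> I" "i \<noteq> j"
  shows "distr M (N i \<Otimes>\<^sub>M N j) (\<lambda>\<omega>. (X i \<omega>, X j \<omega>)) = distr M (N i) (X i) \<Otimes>\<^sub>M distr M (N j) (X j)"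
proof -
  have "indep_var (PiM {i} N) (\<lambda>\<omega>. restrict (\<lambda>i. X i \<omega>) {i}) (PiM {j} N) (\<lambda>\<omega>. restrict (\<lambda>i. X i \<omega>) {j})"
    by (rule indep_var_restrict[OF X]) (use assms in auto)
  then have "indep_var (N i) ((\<lambda>f. f i) \<circ> (\<lambda>\<omega>. restrict (\<lambda>i. X i \<omega>) {i}))
      (N j) ((\<lambda>f. f j) \<circ> (\<lambda>\<omega>. restrict (\<lambda>i. X i \<omega>) {j}))"
    by (rule indep_var_compose) auto
  then show ?thesis
    by (auto simp: indep_var_distribution_eq comp_def)
qed

abbreviation off_diagonal :: "'i set \<Rightarrow> ('i \<times> 'i) set" where
  "off_diagonal I \<equiv> {(i, j). i \<in> I \<and> j \<in> I \<and> i \<noteq> j}"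

lemma finite_off_diagonal: "finite I \<Longrightarrow> finite (off_diagonal I)"
  by (rule finite_subset[of _ "I \<times> I"]) auto

lemma card_off_diagonal: "finite I \<Longrightarrow> real (card (off_diagonal I)) = real (card I) * (real (card I) - 1)"
proof -
  assume I: "finite I"
  have "off_diagonal I = I \<times> I - (\<lambda>i. (i, i)) ` I" by auto
  then have "card (off_diagonal I) = card I * card I - card I"
    using I by (simp add: card_Diff_subset card_cartesian_product card_image inj_on_def image_subset_iff)
  then show ?thesis
    by (cases "card I") (simp_all add: of_nat_diff algebra_simps)
qed

lemma sum_off_diagonal:
  fixes h :: "'i \<Rightarrow> 'i \<Rightarrow> 'b::comm_monoid_add"
  assumes "finite A"
  shows "(\<Sum>(i, j)\<in>off_diagonal A. h i j) = (\<Sum>i\<in>A. \<Sum>j\<in>A. if i = j then 0 else h i j)"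
proof -
  have "(\<Sum>(i, j)\<in>off_diagonal A. h i j) = (\<Sum>(i, j)\<in>A \<times> A. if i = j then 0 else h i j)"
    using assms by (intro sum.mono_neutral_cong_left) auto
  then show ?thesis by (simp add: sum.cartesian_product)
qed

text \<open>Bounded differences for the sum over ordered pairs: one variable occurs in at most
  \<open>2 * card I\<close> pairs, and each of these terms changes by at most \<open>2 * c\<close>.
  With k = card I the squared differences sum to k * (4 * k * c)^2 = 16 * k^3 * c^2, whence the 8 in
  the exponent.\<close>

lemma (in prob_space) U_statistic_bounded_lower_tail:
  fixes H :: "'b \<times> 'b \<Rightarrow> real"
  assumes X: "indep_vars (\<lambda>_. N) X I" and \<mu>: "\<And>i. i \<in> I \<Longrightarrow> distr M N (X i) = \<mu>"
    and I: "finite I" "I \<noteq> {}"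
    and H: "H \<in> borel_measurable (N \<Otimes>\<^sub>M N)" and bound: "\<And>z. \<bar>H z\<bar> \<le> c" and c: "c > 0" and t: "t > 0"
  shows "prob {\<omega> \<in> space M. (\<Sum>(i, j)\<in>off_diagonal I. H (X i \<omega>, X j \<omega>))
      \<le> real (card I) * (real (card I) - 1) * (\<integral>z. H z \<partial>(\<mu> \<Otimes>\<^sub>M \<mu>)) - t}
    \<le> exp (- t\<^sup>2 / (8 * real (card I) ^ 3 * c\<^sup>2))"
proof -
  let ?K = "off_diagonal I" and ?k = "real (card I)"
  define P where "P = PiM I (\<lambda>_. \<mu>)"
  define f where "f x = (\<Sum>(i, j)\<in>?K. H (x i, x j))" for x :: "_ \<Rightarrow> 'b"
  let ?X = "\<lambda>\<omega>. \<lambda>i\<in>I. X i \<omega>"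
  have fK: "finite ?K" by (rule finite_off_diagonal[OF I(1)])
  have rv [measurable]: "X i \<in> measurable M N" if "i \<in> I" for i
    using X that by (auto simp: indep_vars_def)
  obtain i0 where "i0 \<in> I" using I by auto
  then have \<mu>_prob: "prob_space \<mu>" and sets_\<mu>: "sets \<mu> = sets N"
    using prob_space_distr[OF rv] \<mu> by (metis, metis sets_distr)
  interpret P: prob_space P unfolding P_def by (intro prob_space_PiM \<mu>_prob)
  \<comment> \<open>Independence identifies the joint law with the product measure, so the event can
    be moved to the product space, where the inequality is stated.\<close>
  have distr_P: "distr M (PiM I (\<lambda>_. N)) ?X = P"
    using X indep_vars_iff_distr_eq_PiM'[where M' = "\<lambda>_. N" and X = X and I = I] I rv \<mu> by (simp add: P_def cong: PiM_cong)
  have sets_P: "sets P = sets (PiM I (\<lambda>_. N))" unfolding P_def by (intro sets_PiM_cong sets_\<mu> refl)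
  have Xm [measurable]: "?X \<in> measurable M (PiM I (\<lambda>_. N))" by measurable
  have f_N [measurable]: "f \<in> borel_measurable (PiM I (\<lambda>_. N))"
    unfolding f_def case_prod_unfold
    by (intro borel_measurable_sum measurable_compose[OF _ H] measurable_Pair measurable_component_singleton) auto
  then have f_P [measurable]: "f \<in> borel_measurable P"
    by (simp add: measurable_cong_sets[OF sets_P refl])
  have fX: "f (?X \<omega>) = (\<Sum>(i, j)\<in>?K. H (X i \<omega>, X j \<omega>))" for \<omega>
    unfolding f_def by (intro sum.cong) auto
  have "(\<integral>x. f x \<partial>P) = (\<integral>\<omega>. f (?X \<omega>) \<partial>M)"
    unfolding distr_P[symmetric] by (rule integral_distr) measurable
  also have "\<dots> = (\<Sum>(i, j)\<in>?K. \<integral>\<omega>. H (X i \<omega>, X j \<omega>) \<partial>M)"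
    unfolding fX case_prod_unfold
    by (rule Bochner_Integration.integral_sum, rule integrable_const_bound[of _ c])
       (use bound rv H in \<open>auto intro!: measurable_compose[OF _ H]\<close>)
  also have "\<dots> = (\<Sum>(i, j)\<in>?K. \<integral>z. H z \<partial>(\<mu> \<Otimes>\<^sub>M \<mu>))"
  proof (intro sum.cong refl, clarify)
    fix i j assume ij: "i \<in> I" "j \<in> I" "i \<noteq> j"
    have "(\<integral>\<omega>. H (X i \<omega>, X j \<omega>) \<partial>M) = (\<integral>z. H z \<partial>distr M (N \<Otimes>\<^sub>M N) (\<lambda>\<omega>. (X i \<omega>, X j \<omega>)))"
      using ij H by (subst integral_distr) auto
    also have "\<dots> = (\<integral>z. H z \<partial>(\<mu> \<Otimes>\<^sub>M \<mu>))"
      using indep_vars_distr_pair[OF X ij] \<mu> ij by simp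
    finally show "(\<integral>\<omega>. H (X i \<omega>, X j \<omega>) \<partial>M) = (\<integral>z. H z \<partial>(\<mu> \<Otimes>\<^sub>M \<mu>))" .
  qed
  also have "\<dots> = ?k * (?k - 1) * (\<integral>z. H z \<partial>(\<mu> \<Otimes>\<^sub>M \<mu>))"
    using card_off_diagonal[OF I(1)] by (simp add: case_prod_unfold)
  finally have Ef: "(\<integral>x. f x \<partial>P) = ?k * (?k - 1) * (\<integral>z. H z \<partial>(\<mu> \<Otimes>\<^sub>M \<mu>))" .
  have diff: "\<bar>f (x(i := y)) - f x\<bar> \<le> 4 * ?k * c" if i: "i \<in> I" for x i y
  proof -
    \<comment> \<open>Only the pairs that contain the updated index contribute to the
      difference.\<close>
    let ?A = "({i} \<times> I \<union> I \<times> {i}) \<inter> ?K"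
    let ?d = "\<lambda>(a, b). H ((x(i := y)) a, (x(i := y)) b) - H (x a, x b)"
    have "f (x(i := y)) - f x = (\<Sum>p\<in>?K. ?d p)"
      unfolding f_def by (simp add: sum_subtractf case_prod_unfold)
    also have "\<dots> = (\<Sum>p\<in>?A. ?d p)"
      by (rule sum.mono_neutral_right) (use fK in \<open>auto split: if_splits\<close>)
    finally have "\<bar>f (x(i := y)) - f x\<bar> \<le> (\<Sum>p\<in>?A. \<bar>?d p\<bar>)" by simp
    also have "\<dots> \<le> (\<Sum>p\<in>?A. 2 * c)"
    proof (rule sum_mono, clarify)
      fix a b
      show "\<bar>H ((x(i := y)) a, (x(i := y)) b) - H (x a, x b)\<bar> \<le> 2 * c"
        using bound[of "((x(i := y)) a, (x(i := y)) b)"] bound[of "(x a, x b)"] by linarith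
    qed
    also have "\<dots> \<le> 4 * ?k * c"
    proof -
      have "card ?A \<le> card ({i} \<times> I \<union> I \<times> {i})" by (rule card_mono) (use I in auto)
      also have "\<dots> \<le> 2 * card I"
        using card_Un_le[of "{i} \<times> I" "I \<times> {i}"] by (simp add: card_cartesian_product)
      finally show ?thesis using c by simp
    qed
    finally show ?thesis .
  qed
  have B: "\<bar>f x\<bar> \<le> (\<Sum>p\<in>?K. c)" for x
    unfolding f_def case_prod_unfold by (rule order_trans[OF sum_abs sum_mono]) (rule bound)
  have "{\<omega> \<in> space M. f (?X \<omega>) \<le> (\<integral>x. f x \<partial>P) - t}
      = ?X -` {x \<in> space P. f x \<le> (\<integral>x. f x \<partial>P) - t} \<inter> space M"
    using measurable_space[OF Xm] sets_eq_imp_space_eq[OF sets_P] by auto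
  also have "prob \<dots> = measure (distr M (PiM I (\<lambda>_. N)) ?X) {x \<in> space P. f x \<le> (\<integral>x. f x \<partial>P) - t}"
    by (rule measure_distr[symmetric, OF Xm], unfold sets_P[symmetric]) measurable
  also have "\<dots> \<le> exp (- 2 * t\<^sup>2 / (\<Sum>i\<in>I. (4 * ?k * c)\<^sup>2))"
    unfolding distr_P unfolding P_def
    by (rule bounded_differences_lower_tail[OF \<mu>_prob I(1), where B = "(\<Sum>p\<in>?K. c)"])
       (use f_P diff B t c I in \<open>auto simp: P_def card_gt_0_iff\<close>)
  also have "\<dots> = exp (- t\<^sup>2 / (8 * ?k ^ 3 * c\<^sup>2))"
    using I by (simp add: power2_eq_square power3_eq_cube)
  finally show ?thesis unfolding fX Ef .
qed

text \<open>Below the level \<open>c\<close> the error vanishes. Above it the error is at most |x| =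
  |x|^(1-p) |x|^p, and the exponent 1 - p is nonpositive, so |x| may be replaced by \<open>c\<close>
  in the first factor.\<close>

lemma truncation_error_le:
  fixes x c p :: real
  assumes "c > 0" "p \<ge> 1"
  shows "\<bar>x - max (- c) (min c x)\<bar> \<le> c powr (1 - p) * \<bar>x\<bar> powr p"
proof (cases "\<bar>x\<bar> \<le> c")
  case False
  then have x: "\<bar>x\<bar> > c" by simp
  have "\<bar>x - max (- c) (min c x)\<bar> \<le> \<bar>x\<bar>" using assms by linarith
  also have "\<dots> = \<bar>x\<bar> powr (1 - p) * \<bar>x\<bar> powr p"
    using x assms by (simp add: powr_add[symmetric])
  also have "\<dots> \<le> c powr (1 - p) * \<bar>x\<bar> powr p"
    by (intro mult_right_mono powr_mono2') (use x assms in auto)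
  finally show ?thesis .
qed auto

text \<open>The deviation has three sources. The term with the square root is the fluctuation of the
  truncated statistic. Of the two copies of k^(1+\<gamma>) C, one is the Markov threshold for the
  sum of the truncation errors, the other bounds the shift of the mean caused by truncating.\<close>

lemma (in prob_space) U_statistic_lower_tail:
  fixes H :: "'b \<times> 'b \<Rightarrow> real" and p \<gamma> C :: real
  assumes X: "indep_vars (\<lambda>_. N) X I" and \<mu>: "\<And>i. i \<in> I \<Longrightarrow> distr M N (X i) = \<mu>"
    and I: "finite I" "card I \<ge> 2"
    and H [measurable]: "H \<in> borel_measurable (N \<Otimes>\<^sub>M N)"
    and Hp: "integrable (\<mu> \<Otimes>\<^sub>M \<mu>) (\<lambda>z. \<bar>H z\<bar> powr p)"
      "(\<integral>z. \<bar>H z\<bar> powr p \<partial>(\<mu> \<Otimes>\<^sub>M \<mu>)) \<le> C powr p"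
    and C: "C > 0" and p: "p \<ge> 1" "\<gamma> * p > 1"
  defines "k \<equiv> real (card I)" and "L \<equiv> (\<gamma> * p - 1) * ln (real (card I))"
  shows "prob {\<omega> \<in> space M. (\<Sum>(i, j)\<in>off_diagonal I. H (X i \<omega>, X j \<omega>))
      < k * (k - 1) * (\<integral>z. H z \<partial>(\<mu> \<Otimes>\<^sub>M \<mu>))
        - (2 * k powr (1 + \<gamma>) + 2 * sqrt (2 * L) * k powr (3 / 2 + \<gamma>)) * C}
    \<le> 2 * k powr (1 - \<gamma> * p)"
proof -
  let ?K = "off_diagonal I"
  let ?Q = "\<mu> \<Otimes>\<^sub>M \<mu>"
  have k: "k \<ge> 2" and L: "L > 0" using I p by (auto simp: k_def L_def)
  have fK: "finite ?K" by (rule finite_off_diagonal[OF I(1)])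
  have rv [measurable]: "X i \<in> measurable M N" if "i \<in> I" for i
    using X that by (auto simp: indep_vars_def)
  have "I \<noteq> {}" using I by auto
  then obtain i0 where "i0 \<in> I" by auto
  then have \<mu>_prob: "prob_space \<mu>" and sets_\<mu>: "sets \<mu> = sets N"
    using prob_space_distr[OF rv] \<mu> by (metis, metis sets_distr)
  interpret \<mu>: prob_space \<mu> by (rule \<mu>_prob)
  interpret Q: pair_prob_space \<mu> \<mu> ..
  have sets_Q: "sets ?Q = sets (N \<Otimes>\<^sub>M N)" by (intro sets_pair_measure_cong sets_\<mu>)
  define c where "c = k powr \<gamma> * C"
  define G where "G z = max (- c) (min c (H z))" for z
  define D where "D z = \<bar>H z - G z\<bar>" for z
  \<comment> \<open>This is c^(1-p) C^p for c = k^\<gamma> C, the bound on the mean truncation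
    error.\<close>
  define e where "e = k powr (\<gamma> - \<gamma> * p) * C"
  \<comment> \<open>Chosen so that t^2 / (8 k^3 c^2) = L, since exp (- L) = k^(1 - \<gamma>
    p).\<close>
  define t where "t = 2 * sqrt (2 * L) * k powr (3 / 2) * c"
  have c: "c > 0" using k C by (simp add: c_def)
  have t: "t > 0" using L k c by (simp add: t_def)
  have G [measurable]: "G \<in> borel_measurable (N \<Otimes>\<^sub>M N)"
    and D [measurable]: "D \<in> borel_measurable (N \<Otimes>\<^sub>M N)"
    unfolding G_def D_def by measurable
  have Q_borel: "f \<in> borel_measurable ?Q" if "f \<in> borel_measurable (N \<Otimes>\<^sub>M N)" for f :: "_ \<Rightarrow> real"
    using that by (simp add: measurable_cong_sets[OF sets_Q refl])
  have D_le: "D z \<le> c powr (1 - p) * \<bar>H z\<bar> powr p" for z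
    unfolding D_def G_def by (rule truncation_error_le[OF c p(1)])
  have G_le: "\<bar>G z\<bar> \<le> c" for z using c by (auto simp: G_def)
  have D_int: "integrable ?Q D"
    by (rule Bochner_Integration.integrable_bound[OF integrable_mult_right[where c = "c powr (1 - p)", OF Hp(1)] Q_borel[OF D]])
       (use D_le in \<open>auto simp: D_def intro!: AE_I2\<close>)
  have G_int: "integrable ?Q G"
    by (rule Q.P.integrable_const_bound[of _ c]) (use G_le Q_borel[OF G] in auto)
  have H_int: "integrable ?Q H"
    by (rule Bochner_Integration.integrable_bound[OF Bochner_Integration.integrable_add[OF D_int integrable_abs[OF G_int]] Q_borel[OF H]])
       (auto simp: D_def intro!: AE_I2)
  have "(\<integral>z. D z \<partial>?Q) \<le> (\<integral>z. c powr (1 - p) * \<bar>H z\<bar> powr p \<partial>?Q)"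
    by (intro integral_mono D_int integrable_mult_right Hp D_le)
  also have "\<dots> \<le> c powr (1 - p) * C powr p"
    using Hp(2) by (simp add: mult_left_mono)
  also have "\<dots> = e"
    using k C unfolding c_def e_def
    by (simp add: powr_mult powr_powr powr_add[symmetric] algebra_simps)
  finally have D_e: "(\<integral>z. D z \<partial>?Q) \<le> e" .
  have "(\<integral>z. H z \<partial>?Q) - (\<integral>z. G z \<partial>?Q) = (\<integral>z. H z - G z \<partial>?Q)"
    by (rule Bochner_Integration.integral_diff[OF H_int G_int, symmetric])
  also have "\<dots> \<le> (\<integral>z. D z \<partial>?Q)"
    by (intro integral_mono Bochner_Integration.integrable_diff H_int G_int D_int) (auto simp: D_def)
  finally have HG: "(\<integral>z. H z \<partial>?Q) \<le> (\<integral>z. G z \<partial>?Q) + e" using D_e by simp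
  let ?A1 = "{\<omega> \<in> space M. (\<Sum>(i, j)\<in>?K. G (X i \<omega>, X j \<omega>)) \<le> k * (k - 1) * (\<integral>z. G z \<partial>?Q) - t}"
  let ?A2 = "{\<omega> \<in> space M. (\<Sum>(i, j)\<in>?K. D (X i \<omega>, X j \<omega>)) \<ge> k powr (1 + \<gamma>) * C}"
  have pair_rv: "(\<lambda>\<omega>. f (X i \<omega>, X j \<omega>)) \<in> borel_measurable M"
    if "f \<in> borel_measurable (N \<Otimes>\<^sub>M N)" "i \<in> I" "j \<in> I" for f :: "_ \<Rightarrow> real" and i j
    by (rule measurable_compose[OF measurable_Pair[OF rv rv] that(1)]) (use that in auto)
  have sum_rv [measurable]: "(\<lambda>\<omega>. \<Sum>(i, j)\<in>?K. f (X i \<omega>, X j \<omega>)) \<in> borel_measurable M"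
    if "f \<in> borel_measurable (N \<Otimes>\<^sub>M N)" for f :: "_ \<Rightarrow> real"
    unfolding case_prod_unfold by (intro borel_measurable_sum pair_rv that) auto
  have "prob ?A1 \<le> exp (- t\<^sup>2 / (8 * k ^ 3 * c\<^sup>2))"
    unfolding k_def using X \<mu> I(1) \<open>I \<noteq> {}\<close> G G_le c t
    by (rule U_statistic_bounded_lower_tail)
  also have "t\<^sup>2 = 8 * L * (k powr (3 / 2)) ^ 2 * c\<^sup>2"
    using L by (simp add: t_def power_mult_distrib)
  also have "(k powr (3 / 2)) ^ 2 = k ^ 3"
    using k by (simp add: powr_power)
  also have "exp (- (8 * L * k ^ 3 * c\<^sup>2) / (8 * k ^ 3 * c\<^sup>2)) = k powr (1 - \<gamma> * p)"
  proof -
    have "- (8 * L * k ^ 3 * c\<^sup>2) / (8 * k ^ 3 * c\<^sup>2) = - L" using k c by simp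
    then show ?thesis using k by (simp add: powr_def L_def k_def algebra_simps)
  qed
  finally have A1: "prob ?A1 \<le> k powr (1 - \<gamma> * p)" .
  have D_pair: "has_bochner_integral M (\<lambda>\<omega>. D (X i \<omega>, X j \<omega>)) (\<integral>z. D z \<partial>?Q)" if "(i, j) \<in> ?K" for i j
  proof -
    have ij: "i \<in> I" "j \<in> I" "i \<noteq> j" using that by auto
    have m: "(\<lambda>\<omega>. (X i \<omega>, X j \<omega>)) \<in> measurable M (N \<Otimes>\<^sub>M N)" using ij by simp
    have eq: "distr M (N \<Otimes>\<^sub>M N) (\<lambda>\<omega>. (X i \<omega>, X j \<omega>)) = ?Q"
      using indep_vars_distr_pair[OF X ij] \<mu> ij by simp
    show ?thesis
      using integrable_distr[OF m] integral_distr[OF m D] D_int unfolding eq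
      by (simp add: has_bochner_integral_iff)
  qed
  have D_sum: "has_bochner_integral M (\<lambda>\<omega>. \<Sum>(i, j)\<in>?K. D (X i \<omega>, X j \<omega>))
      (\<Sum>p\<in>?K. \<integral>z. D z \<partial>?Q)"
    unfolding case_prod_unfold by (rule has_bochner_integral_sum) (use D_pair in auto)
  \<comment> \<open>Markov's inequality: the expected total error is at most k^2 e, and dividing by
    k^(1+\<gamma>) C leaves k^(1 - \<gamma> p), the same bound as for \<open>?A1\<close>.\<close>
  have "prob ?A2 \<le> (\<Sum>p\<in>?K. \<integral>z. D z \<partial>?Q) / (k powr (1 + \<gamma>) * C)"
    using integral_Markov_inequality_measure[of M "\<lambda>\<omega>. \<Sum>(i, j)\<in>?K. D (X i \<omega>, X j \<omega>)" "{}" "k powr (1 + \<gamma>) * C"]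
      D_sum k C
    by (simp add: has_bochner_integral_iff AE_I2 sum_nonneg D_def case_prod_unfold)
  also have "(\<Sum>p\<in>?K. \<integral>z. D z \<partial>?Q) = k * (k - 1) * (\<integral>z. D z \<partial>?Q)"
    using card_off_diagonal[OF I(1)] by (simp add: k_def)
  also have "\<dots> / (k powr (1 + \<gamma>) * C) \<le> k\<^sup>2 * e / (k powr (1 + \<gamma>) * C)"
    using k D_e C
    by (intro divide_right_mono mult_mono) (auto simp: power2_eq_square D_def)
  also have "\<dots> = k powr 2 * k powr (\<gamma> - \<gamma> * p) / k powr (1 + \<gamma>)"
    using k C by (simp add: e_def)
  also have "\<dots> = k powr (1 - \<gamma> * p)"
    unfolding powr_add[symmetric] powr_diff[symmetric] by (simp add: algebra_simps)
  finally have A2: "prob ?A2 \<le> k powr (1 - \<gamma> * p)" .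
  \<comment> \<open>The shift of the mean fits into the second copy of k^(1+\<gamma>) C because
    \<open>\<gamma> * p > 1\<close>.\<close>
  have "k * (k - 1) * e \<le> k powr 2 * e"
    using k C by (intro mult_right_mono) (auto simp: power2_eq_square e_def)
  also have "\<dots> = k powr (2 + (\<gamma> - \<gamma> * p)) * C" by (simp add: e_def powr_add)
  also have "\<dots> \<le> k powr (1 + \<gamma>) * C"
    using k p C by (intro mult_right_mono powr_mono) auto
  finally have ke: "k * (k - 1) * e \<le> k powr (1 + \<gamma>) * C" .
  have t_eq: "2 * sqrt (2 * L) * k powr (3 / 2 + \<gamma>) * C = t"
    by (simp add: t_def c_def powr_add)
  have mean: "k * (k - 1) * (\<integral>z. H z \<partial>?Q) \<le> k * (k - 1) * (\<integral>z. G z \<partial>?Q) + k * (k - 1) * e"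
    using mult_left_mono[OF HG, of "k * (k - 1)"] k by (simp add: distrib_left)
  have "{\<omega> \<in> space M. (\<Sum>(i, j)\<in>?K. H (X i \<omega>, X j \<omega>)) < k * (k - 1) * (\<integral>z. H z \<partial>?Q)
        - (2 * k powr (1 + \<gamma>) + 2 * sqrt (2 * L) * k powr (3 / 2 + \<gamma>)) * C} \<subseteq> ?A1 \<union> ?A2"
  proof (rule subsetI, rule ccontr)
    fix \<omega> assume \<omega>: "\<omega> \<in> {\<omega> \<in> space M. (\<Sum>(i, j)\<in>?K. H (X i \<omega>, X j \<omega>)) < k * (k - 1) * (\<integral>z. H z \<partial>?Q)
        - (2 * k powr (1 + \<gamma>) + 2 * sqrt (2 * L) * k powr (3 / 2 + \<gamma>)) * C}" "\<omega> \<notin> ?A1 \<union> ?A2"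
    have "(\<Sum>(i, j)\<in>?K. G (X i \<omega>, X j \<omega>)) - (\<Sum>(i, j)\<in>?K. D (X i \<omega>, X j \<omega>))
        \<le> (\<Sum>(i, j)\<in>?K. H (X i \<omega>, X j \<omega>))"
      unfolding case_prod_unfold sum_subtractf[symmetric] by (rule sum_mono) (auto simp: D_def)
    then show False
      using \<omega> ke mean t_eq by (auto simp: distrib_right)
  qed
  then have "prob {\<omega> \<in> space M. (\<Sum>(i, j)\<in>?K. H (X i \<omega>, X j \<omega>)) < k * (k - 1) * (\<integral>z. H z \<partial>?Q)
        - (2 * k powr (1 + \<gamma>) + 2 * sqrt (2 * L) * k powr (3 / 2 + \<gamma>)) * C} \<le> prob (?A1 \<union> ?A2)"
    by (intro finite_measure_mono) (use sum_rv[OF G] sum_rv[OF D] in measurable)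
  also have "\<dots> \<le> prob ?A1 + prob ?A2"
    by (rule measure_Un_le) (use sum_rv[OF G] sum_rv[OF D] in measurable)
  finally show ?thesis using A1 A2 by simp
qed

subsection \<open>Integrals over Lebesgue measurable rectangles\<close>

lemma unit_square_sets: "unit_square \<in> sets borel"
  using borel_Times[of "{0..1::real}" "{0..1::real}"] by simp

lemma borel_measurable_completion_AE:
  assumes g: "g \<in> borel_measurable M" and ae: "AE x in M. f x = g x"
  shows "f \<in> borel_measurable (completion M)"
proof (rule measurableI)
  fix A assume A: "A \<in> sets (borel :: 'b measure)"
  have "g -` A \<inter> space M \<in> sets (completion M)"
    using measurable_sets[OF g A] by simp
  then have "f -` A \<inter> space (completion M) \<in> sets (completion M)"
    by (rule completion.in_sets_AE[rotated]) (use AE_completion[OF ae] in auto)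
  then show "f -` A \<inter> space (completion M) \<in> sets (completion M)" .
qed simp

text \<open>A Lebesgue measurable function cannot be composed with Borel random variables without
  leaving their \<sigma>-algebra; a Borel representative can.\<close>

lemma lebesgue_on_ex_borel_measurable:
  fixes g :: "'a::euclidean_space \<Rightarrow> real"
  assumes A: "A \<in> sets lebesgue" and g: "g \<in> borel_measurable (lebesgue_on A)"
  obtains g' where "g' \<in> borel_measurable borel" "AE z in lborel. z \<in> A \<longrightarrow> g z = g' z"
proof -
  have "(\<lambda>z. indicator A z *\<^sub>R g z) \<in> borel_measurable lebesgue"
    using g A by (subst (asm) borel_measurable_restrict_space_iff) auto
  then obtain g' where g': "g' \<in> borel_measurable lborel" "AE z in lborel. indicator A z *\<^sub>R g z = g' z"
    using completion_ex_borel_measurable_real by blast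
  have "AE z in lborel. z \<in> A \<longrightarrow> g z = g' z"
    using g'(2) by eventually_elim auto
  then show thesis using that g'(1) by simp
qed

lemma lebesgue_ex_borel_subset:
  fixes S :: "'a::euclidean_space set"
  assumes "S \<in> sets lebesgue"
  obtains S' where "S' \<in> sets borel" "S' \<subseteq> S" "AE x in lborel. x \<in> S \<longleftrightarrow> x \<in> S'"
proof
  show "main_part lborel S \<in> sets borel" "main_part lborel S \<subseteq> S"
    using main_part_sets[OF assms] main_part_null_part_Un[OF assms] by auto
  show "AE x in lborel. x \<in> S \<longleftrightarrow> x \<in> main_part lborel S"
    using AE_in_main_part[OF assms] by (simp add: eq_commute)
qed

lemma AE_lborel_fst_snd:
  fixes P :: "'a::euclidean_space \<Rightarrow> bool" and Q :: "'b::euclidean_space \<Rightarrow> bool"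
  assumes "AE x in lborel. P x" "AE y in lborel. Q y"
  shows "AE z in lborel. P (fst z) \<and> Q (snd z)"
proof -
  obtain N where N: "{x. \<not> P x} \<subseteq> N" "N \<in> null_sets lborel"
    using assms(1) by (auto simp: eventually_ae_filter)
  obtain N' where N': "{y. \<not> Q y} \<subseteq> N'" "N' \<in> null_sets lborel"
    using assms(2) by (auto simp: eventually_ae_filter)
  have "N \<times> UNIV \<in> null_sets (lborel \<Otimes>\<^sub>M lborel :: ('a \<times> 'b) measure)"
    "UNIV \<times> N' \<in> null_sets (lborel \<Otimes>\<^sub>M lborel :: ('a \<times> 'b) measure)"
    using N(2) N'(2) by (auto intro: lborel.times_in_null_sets1 lborel.times_in_null_sets2)
  then have "N \<times> UNIV \<union> UNIV \<times> N' \<in> null_sets (lborel :: ('a \<times> 'b) measure)"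
    unfolding lborel_prod by (rule null_sets.Un)
  then show ?thesis
    by (rule AE_I') (use N(1) N'(1) in auto)
qed

text \<open>Inner Borel parts of \<open>S\<close> and \<open>T\<close> differ from them by null
  sets, and cylinders over null sets are null in the plane. Taking subsets keeps
  \<open>S' \<times> T'\<close> inside the square, the only place where \<open>V\<close> and
  \<open>g\<close> are compared. The sets are fixed before the integrand.\<close>

lemma set_integral_Times_borel:
  fixes S T :: "real set"
  assumes S: "S \<in> sets lebesgue" "S \<subseteq> {0..1}" and T: "T \<in> sets lebesgue" "T \<subseteq> {0..1}"
  obtains S' T' where "S' \<in> sets borel" "S' \<subseteq> S" "T' \<in> sets borel" "T' \<subseteq> T"
    "\<And>V g :: real \<times> real \<Rightarrow> real. g \<in> borel_measurable borel \<Longrightarrow>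
      AE z in lborel. z \<in> unit_square \<longrightarrow> V z = g z \<Longrightarrow>
      (LINT z:S \<times> T|lebesgue. V z) = (LINT z:S' \<times> T'|lborel. g z)"
proof -
  obtain S' where S': "S' \<in> sets borel" "S' \<subseteq> S" "AE x in lborel. x \<in> S \<longleftrightarrow> x \<in> S'"
    using lebesgue_ex_borel_subset[OF S(1)] .
  obtain T' where T': "T' \<in> sets borel" "T' \<subseteq> T" "AE x in lborel. x \<in> T \<longleftrightarrow> x \<in> T'"
    using lebesgue_ex_borel_subset[OF T(1)] .
  note ae = AE_lborel_fst_snd[OF S'(3) T'(3)]
  have "(LINT z:S \<times> T|lebesgue. V z) = (LINT z:S' \<times> T'|lborel. g z)"
    if g: "g \<in> borel_measurable borel" and V: "AE z in lborel. z \<in> unit_square \<longrightarrow> V z = g z"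
    for V g :: "real \<times> real \<Rightarrow> real"
  proof -
    let ?f = "\<lambda>z. indicator (S \<times> T) z *\<^sub>R V z" and ?g = "\<lambda>z. indicator (S' \<times> T') z *\<^sub>R g z"
    have ae': "AE z in lborel. ?f z = ?g z"
      using ae V by eventually_elim (use S T S' T' in \<open>auto simp: indicator_def\<close>)
    have gm: "?g \<in> borel_measurable lborel"
      using g borel_Times[OF S'(1) T'(1)] by simp
    have "integral\<^sup>L lebesgue ?f = integral\<^sup>L lebesgue ?g"
      by (intro integral_cong_AE borel_measurable_completion_AE[OF gm ae'] AE_completion ae' measurable_completion gm)
    also have "\<dots> = integral\<^sup>L lborel ?g" by (rule integral_completion[OF gm])
    finally show ?thesis by (simp add: set_lebesgue_integral_def)
  qed
  from that[OF S'(1,2) T'(1,2) this] show thesis .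
qed

section \<open>Extreme points of boxes of weights\<close>

text \<open>A linear form on the box [0, c]^A is maximal at a vertex: weight \<open>c\<close> where
  the coefficient is positive, weight 0 elsewhere.\<close>

lemma weighted_sum_le_subset_sum:
  fixes b s :: "'i \<Rightarrow> real"
  assumes "finite A" "\<And>i. i \<in> A \<Longrightarrow> 0 \<le> s i" "\<And>i. i \<in> A \<Longrightarrow> s i \<le> c"
  obtains I where "I \<subseteq> A" "(\<Sum>i\<in>A. s i * b i) \<le> c * (\<Sum>i\<in>I. b i)"
proof
  let ?I = "{i \<in> A. b i > 0}"
  show "?I \<subseteq> A" by auto
  have "(\<Sum>i\<in>A. s i * b i) \<le> (\<Sum>i\<in>A. if b i > 0 then c * b i else 0)"
    using assms by (intro sum_mono) (auto simp: mult_nonneg_nonpos intro: mult_right_mono)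
  also have "\<dots> = c * (\<Sum>i\<in>?I. b i)"
    using assms(1) by (simp add: sum_distrib_left sum.inter_filter if_distrib[where f = "(*) c"] cong: if_cong)
  finally show "(\<Sum>i\<in>A. s i * b i) \<le> c * (\<Sum>i\<in>?I. b i)" .
qed

lemma weighted_double_sum_le:
  fixes a :: "'i \<Rightarrow> 'j \<Rightarrow> real"
  assumes fin: "finite A" "finite A'" and c: "c \<ge> 0"
    and s: "\<And>i. i \<in> A \<Longrightarrow> 0 \<le> s i" "\<And>i. i \<in> A \<Longrightarrow> s i \<le> c"
    and t: "\<And>j. j \<in> A' \<Longrightarrow> 0 \<le> t j" "\<And>j. j \<in> A' \<Longrightarrow> t j \<le> c"
    and B: "\<And>I J. I \<subseteq> A \<Longrightarrow> J \<subseteq> A' \<Longrightarrow> (\<Sum>i\<in>I. \<Sum>j\<in>J. a i j) \<le> B"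
  shows "(\<Sum>i\<in>A. \<Sum>j\<in>A'. s i * t j * a i j) \<le> c\<^sup>2 * B"
proof -
  obtain I where I: "I \<subseteq> A"
    "(\<Sum>i\<in>A. s i * (\<Sum>j\<in>A'. t j * a i j)) \<le> c * (\<Sum>i\<in>I. \<Sum>j\<in>A'. t j * a i j)"
    by (rule weighted_sum_le_subset_sum[OF fin(1) s])
  \<comment> \<open>By bilinearity the second box is treated with the first vertex \<open>I\<close>
    already fixed: the coefficients are now the sums over \<open>I\<close>.\<close>
  obtain J where J: "J \<subseteq> A'"
    "(\<Sum>j\<in>A'. t j * (\<Sum>i\<in>I. a i j)) \<le> c * (\<Sum>j\<in>J. \<Sum>i\<in>I. a i j)"
    by (rule weighted_sum_le_subset_sum[OF fin(2) t])
  have "(\<Sum>i\<in>A. \<Sum>j\<in>A'. s i * t j * a i j) = (\<Sum>i\<in>A. s i * (\<Sum>j\<in>A'. t j * a i j))"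
    by (simp add: sum_distrib_left mult.assoc)
  also have "\<dots> \<le> c * (\<Sum>i\<in>I. \<Sum>j\<in>A'. t j * a i j)" by (rule I)
  also have "(\<Sum>i\<in>I. \<Sum>j\<in>A'. t j * a i j) = (\<Sum>j\<in>A'. t j * (\<Sum>i\<in>I. a i j))"
    by (subst sum.swap) (simp add: sum_distrib_left)
  also have "c * \<dots> \<le> c * (c * (\<Sum>j\<in>J. \<Sum>i\<in>I. a i j))"
    by (rule mult_left_mono[OF J(2) c])
  also have "(\<Sum>j\<in>J. \<Sum>i\<in>I. a i j) = (\<Sum>i\<in>I. \<Sum>j\<in>J. a i j)" by (rule sum.swap)
  also have "c * (c * \<dots>) \<le> c\<^sup>2 * B"
    using B[OF I(1) J(1)] c by (simp add: power2_eq_square mult_left_mono mult.assoc)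
  finally show ?thesis .
qed

subsection \<open>The cut norm of a sampled step function\<close>

abbreviation step_interval :: "nat \<Rightarrow> nat \<Rightarrow> real set" where
  "step_interval k i \<equiv> {(real i - 1) / real k..<real i / real k}"

lemma sampled_step_apply:
  "blinfun_apply (sampled_step k U x z) f = (\<Sum>i=1..k. \<Sum>j=1..k.
     indicator (step_interval k i \<times> step_interval k j) z *
       (if i = j then 0 else blinfun_apply (U (x i, x j)) f))"
  unfolding sampled_step_def
  by (auto simp: blinfun.sum_left blinfun.scaleR_left intro!: sum.cong)

lemma sampled_step_apply_measurable:
  "(\<lambda>z. blinfun_apply (sampled_step k U x z) f) \<in> borel_measurable borel"
  unfolding sampled_step_apply
  by (intro borel_measurable_sum borel_measurable_times borel_measurable_indicator borel_Times
      borel_measurable_const) auto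

text \<open>The integral sees \<open>S\<close> and \<open>T\<close> only through the lengths of
  their intersections with the steps, and it is bilinear in these two vectors of lengths. The
  supremum over sets thus becomes a finite-dimensional problem.\<close>

lemma integral_sampled_step:
  assumes "k > 0" and S: "S \<in> sets borel" and T: "T \<in> sets borel"
  shows "(LINT z:S \<times> T|lborel. blinfun_apply (sampled_step k U x z) f) = (\<Sum>i=1..k. \<Sum>j=1..k.
     measure lborel (S \<inter> step_interval k i) * measure lborel (T \<inter> step_interval k j) *
       (if i = j then 0 else blinfun_apply (U (x i, x j)) f))"
proof -
  let ?a = "\<lambda>i j. if i = j then 0 else blinfun_apply (U (x i, x j)) f"
  let ?R = "\<lambda>i j. (S \<inter> step_interval k i) \<times> (T \<inter> step_interval k j)"
  have fin: "emeasure lborel (S \<inter> step_interval k i) \<noteq> \<infinity>" for S :: "real set" and i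
  proof -
    have "emeasure lborel (S \<inter> step_interval k i) \<le> emeasure lborel {(real i - 1) / real k..real i / real k}"
      by (rule emeasure_mono) auto
    then show ?thesis by (auto simp: top_unique emeasure_lborel_Icc_eq split: if_splits)
  qed
  have em: "emeasure lborel (?R i j) =
      emeasure lborel (S \<inter> step_interval k i) * emeasure lborel (T \<inter> step_interval k j)" for i j
    unfolding lborel_prod[symmetric] using S T by (intro lborel.emeasure_pair_measure_Times) auto
  have R: "?R i j \<in> sets lborel" for i j using borel_Times[of "S \<inter> step_interval k i" "T \<inter> step_interval k j"] S T by simp
  have hb: "has_bochner_integral lborel (\<lambda>z. indicator (?R i j) z * ?a i j)
    (measure lborel (S \<inter> step_interval k i) * measure lborel (T \<inter> step_interval k j) * ?a i j)" for i j
  proof -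
    have "measure lborel (?R i j) = measure lborel (S \<inter> step_interval k i) * measure lborel (T \<inter> step_interval k j)"
      unfolding measure_def em by (simp add: enn2real_mult)
    moreover have "has_bochner_integral lborel (\<lambda>z. indicator (?R i j) z * ?a i j) (measure lborel (?R i j) * ?a i j)"
      by (intro has_bochner_integral_mult_left has_bochner_integral_real_indicator R)
         (use fin em in \<open>auto simp: ennreal_mult_less_top less_top\<close>)
    ultimately show ?thesis by simp
  qed
  have "(LINT z:S \<times> T|lborel. blinfun_apply (sampled_step k U x z) f)
      = (\<integral>z. (\<Sum>i=1..k. \<Sum>j=1..k. indicator (?R i j) z * ?a i j) \<partial>lborel)"
    unfolding set_lebesgue_integral_def sampled_step_apply scaleR_sum_right
    by (intro Bochner_Integration.integral_cong refl sum.cong) (auto simp: indicator_def)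
  also have "\<dots> = (\<Sum>i=1..k. \<Sum>j=1..k.
      measure lborel (S \<inter> step_interval k i) * measure lborel (T \<inter> step_interval k j) * ?a i j)"
    by (intro has_bochner_integral_integral_eq has_bochner_integral_sum hb)
  finally show ?thesis .
qed


text \<open>Kept as an element of the dual rather than as a scalar for each \<open>f\<close>, so
  that the supremum over unit vectors turns into its norm.\<close>

definition off_diagonal_sum ::
  "(real \<times> real \<Rightarrow> ('z::real_normed_vector \<Rightarrow>\<^sub>L real)) \<Rightarrow> (nat \<Rightarrow> real) \<Rightarrow> nat set \<Rightarrow> nat set
     \<Rightarrow> ('z \<Rightarrow>\<^sub>L real)" where
  "off_diagonal_sum U x I J = (\<Sum>i\<in>I. \<Sum>j\<in>J. if i = j then 0 else U (x i, x j))"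

lemma off_diagonal_sum_apply:
  "blinfun_apply (off_diagonal_sum U x I J) f =
     (\<Sum>i\<in>I. \<Sum>j\<in>J. if i = j then 0 else blinfun_apply (U (x i, x j)) f)"
  unfolding off_diagonal_sum_def by (auto simp: blinfun.sum_left intro!: sum.cong)

lemma measure_step_interval: "k > 0 \<Longrightarrow> measure lborel (step_interval k i) = 1 / real k"
  by (simp add: field_simps)

lemma step_interval_disjoint:
  assumes "k > 0" "i \<noteq> j"
  shows "step_interval k i \<inter> step_interval k j = {}"
proof -
  have "real j \<le> real i - 1 \<or> real i \<le> real j - 1" using assms(2) by linarith
  then show ?thesis
  proof
    assume "real j \<le> real i - 1"
    then have "real j / real k \<le> (real i - 1) / real k" by (simp add: divide_right_mono)
    then show ?thesis by auto
  next
    assume "real i \<le> real j - 1"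
    then have "real i / real k \<le> (real j - 1) / real k" by (simp add: divide_right_mono)
    then show ?thesis by auto
  qed
qed

lemma step_interval_unit:
  assumes "k > 0" "i \<in> {1..k}"
  shows "step_interval k i \<subseteq> {0..1}"
proof
  fix x assume x: "x \<in> step_interval k i"
  have "0 \<le> (real i - 1) / real k" using assms by (intro divide_nonneg_nonneg) auto
  moreover have "real i / real k \<le> 1" using assms by simp
  ultimately show "x \<in> {0..1}" using x unfolding atLeastLessThan_iff atLeastAtMost_iff by linarith
qed

text \<open>Each step meets a set in length between 0 and \<open>1 / real k\<close>. A bilinear form
  in such weights is at most \<open>1 / (real k)^2\<close> times its largest value over pairs of
  index sets.\<close>

lemma abs_integral_sampled_step_le:
  assumes k: "k > 0"
    and B: "\<And>I J. I \<subseteq> {1..k} \<Longrightarrow> J \<subseteq> {1..k} \<Longrightarrow> \<bar>blinfun_apply (off_diagonal_sum U x I J) f\<bar> \<le> B"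
    and S: "S \<in> sets lebesgue" "S \<subseteq> {0..1}" and T: "T \<in> sets lebesgue" "T \<subseteq> {0..1}"
  shows "\<bar>LINT z:S \<times> T|lebesgue. blinfun_apply (sampled_step k U x z) f\<bar> \<le> B / (real k)\<^sup>2"
proof -
  obtain S' T' where ST: "S' \<in> sets borel" "S' \<subseteq> S" "T' \<in> sets borel" "T' \<subseteq> T"
    and eq: "\<And>V g :: real \<times> real \<Rightarrow> real. g \<in> borel_measurable borel \<Longrightarrow>
      AE z in lborel. z \<in> unit_square \<longrightarrow> V z = g z \<Longrightarrow>
      (LINT z:S \<times> T|lebesgue. V z) = (LINT z:S' \<times> T'|lborel. g z)"
    by (rule set_integral_Times_borel[OF S T]) (rule that)
  let ?s = "\<lambda>S i. measure lborel (S \<inter> step_interval k i)"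
  let ?a = "\<lambda>i j. if i = j then 0 else blinfun_apply (U (x i, x j)) f"
  have s: "?s S i \<le> 1 / real k" if "S \<in> sets borel" for S :: "real set" and i
  proof (subst measure_step_interval[OF k, of i, symmetric], rule measure_mono_fmeasurable)
    have "emeasure lborel (step_interval k i) = ennreal (real i / real k - (real i - 1) / real k)"
      by (rule emeasure_lborel_Ico) (simp add: divide_right_mono)
    then show "step_interval k i \<in> fmeasurable lborel" by (intro fmeasurableI) auto
  qed (use that in auto)
  \<comment> \<open>Both signs are recorded because the vertex argument gives only upper bounds; the
    absolute value needs it for the entries and for their negatives.\<close>
  have B': "(\<Sum>i\<in>I. \<Sum>j\<in>J. ?a i j) \<le> B" "(\<Sum>i\<in>I. \<Sum>j\<in>J. - ?a i j) \<le> B"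
    if "I \<subseteq> {1..k}" "J \<subseteq> {1..k}" for I J
    using B[OF that] unfolding off_diagonal_sum_apply sum_negf by (simp_all only: abs_le_iff)
  have "(\<Sum>i=1..k. \<Sum>j=1..k. ?s S' i * ?s T' j * ?a i j) \<le> (1 / real k)\<^sup>2 * B"
    by (rule weighted_double_sum_le[OF _ _ _ _ s[OF ST(1)] _ s[OF ST(3)] B'(1)]) simp_all
  moreover have "(\<Sum>i=1..k. \<Sum>j=1..k. ?s S' i * ?s T' j * - ?a i j) \<le> (1 / real k)\<^sup>2 * B"
    by (rule weighted_double_sum_le[OF _ _ _ _ s[OF ST(1)] _ s[OF ST(3)] B'(2)]) simp_all
  moreover have "(\<Sum>i=1..k. \<Sum>j=1..k. ?s S' i * ?s T' j * - ?a i j)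
      = - (\<Sum>i=1..k. \<Sum>j=1..k. ?s S' i * ?s T' j * ?a i j)"
    by (simp only: mult_minus_right sum_negf)
  moreover have "(1 / real k)\<^sup>2 * B = B / (real k)\<^sup>2" by (simp add: power_divide)
  moreover have "(LINT z:S \<times> T|lebesgue. blinfun_apply (sampled_step k U x z) f)
      = (\<Sum>i=1..k. \<Sum>j=1..k. ?s S' i * ?s T' j * ?a i j)"
    unfolding integral_sampled_step[OF k ST(1,3), symmetric]
    by (rule eq[OF sampled_step_apply_measurable]) simp
  ultimately show ?thesis unfolding abs_le_iff by linarith
qed

lemma real_cut_norm_le:
  assumes "\<And>S T. S \<in> sets lebesgue \<Longrightarrow> S \<subseteq> {0..1} \<Longrightarrow> T \<in> sets lebesgue \<Longrightarrow> T \<subseteq> {0..1} \<Longrightarrow>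
    \<bar>LINT z:S \<times> T|lebesgue. V z\<bar> \<le> c"
  shows "real_cut_norm V \<le> c"
  unfolding real_cut_norm_def
proof (rule cSUP_least)
  show "{(S, T). S \<in> sets lebesgue \<and> S \<subseteq> {0..1::real} \<and> T \<in> sets lebesgue \<and> T \<subseteq> {0..1::real}} \<noteq> {}"
    by blast
  show "(case p of (S, T) \<Rightarrow> \<bar>LINT z:S \<times> T|lebesgue. V z\<bar>) \<le> c"
    if "p \<in> {(S, T). S \<in> sets lebesgue \<and> S \<subseteq> {0..1} \<and> T \<in> sets lebesgue \<and> T \<subseteq> {0..1}}" for p
    using assms[of "fst p" "snd p"] that by (simp add: case_prod_unfold)
qed

lemma cut_norm_sampled_step_le:
  assumes k: "k > 0" and c: "c \<ge> 0"
    and norm_le: "\<And>I J. I \<subseteq> {1..k} \<Longrightarrow> J \<subseteq> {1..k} \<Longrightarrow> norm (off_diagonal_sum U x I J) \<le> c * (real k)\<^sup>2"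
  shows "cut_norm (sampled_step k U x) \<le> c"
  unfolding cut_norm_def
proof (rule cSup_least)
  fix y assume "y \<in> insert 0 ((\<lambda>f. real_cut_norm (\<lambda>z. blinfun_apply (sampled_step k U x z) f)) ` {f. norm f = 1})"
  then consider "y = 0" | f where "norm f = 1" "y = real_cut_norm (\<lambda>z. blinfun_apply (sampled_step k U x z) f)"
    by blast
  then show "y \<le> c"
  proof cases
    case (2 f)
    show ?thesis
      unfolding 2(2)
    proof (rule real_cut_norm_le)
      fix S T :: "real set"
      assume "S \<in> sets lebesgue" "S \<subseteq> {0..1}" "T \<in> sets lebesgue" "T \<subseteq> {0..1}"
      then have "\<bar>LINT z:S \<times> T|lebesgue. blinfun_apply (sampled_step k U x z) f\<bar> \<le> c * (real k)\<^sup>2 / (real k)\<^sup>2"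
      proof (intro abs_integral_sampled_step_le[OF k])
        fix I J assume "I \<subseteq> {1..k}" "J \<subseteq> {1..k}"
        from norm_le[OF this] show "\<bar>blinfun_apply (off_diagonal_sum U x I J) f\<bar> \<le> c * (real k)\<^sup>2"
          using norm_blinfun[of "off_diagonal_sum U x I J" f] unfolding 2(1) real_norm_def by linarith
      qed
      then show "\<bar>LINT z:S \<times> T|lebesgue. blinfun_apply (sampled_step k U x z) f\<bar> \<le> c"
        using k by simp
    qed
  qed (simp add: c)
qed simp

text \<open>A supremum of reals dominates its members only if the set is bounded. For fixed
  \<open>x\<close> finitely many values of \<open>U\<close> occur, and the sum of their norms bounds
  both suprema without any integrability.\<close>

lemma bdd_above_cut_norm_sampled_step:
  fixes U :: "real \<times> real \<Rightarrow> ('z::real_normed_vector \<Rightarrow>\<^sub>L real)"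
  assumes k: "k > 0"
  shows "norm f = 1 \<Longrightarrow> bdd_above ((\<lambda>(S, T). \<bar>LINT z:S \<times> T|lebesgue. blinfun_apply (sampled_step k U x z) f\<bar>) `
      {(S, T). S \<in> sets lebesgue \<and> S \<subseteq> {0..1} \<and> T \<in> sets lebesgue \<and> T \<subseteq> {0..1}})"
    and "bdd_above (insert 0 ((\<lambda>f. real_cut_norm (\<lambda>z. blinfun_apply (sampled_step k U x z) f)) ` {f. norm f = 1}))"
proof -
  define B where "B = (\<Sum>i=1..k. \<Sum>j=1..k. norm (if i = j then 0 else U (x i, x j)))"
  have B: "\<bar>blinfun_apply (off_diagonal_sum U x I J) f\<bar> \<le> B"
    if "norm f = 1" "I \<subseteq> {1..k}" "J \<subseteq> {1..k}" for f I J
  proof -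
    have "\<bar>blinfun_apply (off_diagonal_sum U x I J) f\<bar> \<le> norm (off_diagonal_sum U x I J)"
      using norm_blinfun[of "off_diagonal_sum U x I J" f] that(1) by simp
    also have "\<dots> \<le> (\<Sum>i\<in>I. \<Sum>j\<in>J. norm (if i = j then 0 else U (x i, x j)))"
      unfolding off_diagonal_sum_def by (intro sum_norm_le order.refl)
    also have "\<dots> \<le> B"
      unfolding B_def sum.cartesian_product
      by (rule sum_mono2) (use that(2,3) in auto)
    finally show ?thesis .
  qed
  note le = abs_integral_sampled_step_le[OF k B]
  let ?V = "\<lambda>f z. blinfun_apply (sampled_step k U x z) f"
  let ?ST = "{(S, T). S \<in> sets lebesgue \<and> S \<subseteq> {0..1::real} \<and> T \<in> sets lebesgue \<and> T \<subseteq> {0..1::real}}"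
  have cut_le: "real_cut_norm (?V f) \<le> B / (real k)\<^sup>2" if "norm f = 1" for f
    by (rule real_cut_norm_le) (rule le[OF that])
  show "bdd_above ((\<lambda>(S, T). \<bar>LINT z:S \<times> T|lebesgue. ?V f z\<bar>) ` ?ST)" if "norm f = 1" for f
  proof (rule bdd_aboveI2[where M = "B / (real k)\<^sup>2"])
    show "(case p of (S, T) \<Rightarrow> \<bar>LINT z:S \<times> T|lebesgue. ?V f z\<bar>) \<le> B / (real k)\<^sup>2" if "p \<in> ?ST" for p
      using le[OF \<open>norm f = 1\<close>, where S = "fst p" and T = "snd p"] that by (simp add: case_prod_unfold)
  qed
  show "bdd_above (insert 0 ((\<lambda>f. real_cut_norm (?V f)) ` {f. norm f = 1}))"
    unfolding bdd_above_insert by (rule bdd_aboveI2[where M = "B / (real k)\<^sup>2"]) (simp add: cut_le)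
qed

lemma cut_norm_sampled_step_nonneg: "k > 0 \<Longrightarrow> 0 \<le> cut_norm (sampled_step k U x)"
  unfolding cut_norm_def by (rule cSup_upper[OF insertI1 bdd_above_cut_norm_sampled_step(2)])

text \<open>Take for \<open>S\<close> and \<open>T\<close> the unions of the steps indexed by
  \<open>I\<close> and \<open>J\<close>. The steps are disjoint, so the weights are exactly
  \<open>1 / real k\<close> or 0, and the integral is the off-diagonal sum divided by
  \<open>(real k)^2\<close>.\<close>

lemma off_diagonal_sum_le_cut_norm:
  assumes k: "k > 0" and f: "norm f = 1" and I: "I \<subseteq> {1..k}" and J: "J \<subseteq> {1..k}"
  shows "\<bar>blinfun_apply (off_diagonal_sum U x I J) f\<bar> \<le> cut_norm (sampled_step k U x) * (real k)\<^sup>2"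
proof -
  let ?V = "\<lambda>f z. blinfun_apply (sampled_step k U x z) f"
  define S where "S I = (\<Union>i\<in>I. step_interval k i)" for I
  have S_int: "S I \<inter> step_interval k i = (if i \<in> I then step_interval k i else {})" for I i
  proof -
    have "S I \<inter> step_interval k i = (\<Union>j\<in>I. step_interval k j \<inter> step_interval k i)"
      unfolding S_def by blast
    also have "\<dots> = (\<Union>j\<in>I. if j = i then step_interval k i else {})"
    proof (intro SUP_cong refl)
      fix j show "step_interval k j \<inter> step_interval k i = (if j = i then step_interval k i else {})"
        using step_interval_disjoint[OF k, of j i] by (cases "j = i") simp_all
    qed
    also have "\<dots> = (if i \<in> I then step_interval k i else {})" by (simp split: if_split)
    finally show ?thesis .
  qed
  have S_meas: "measure lborel (S I \<inter> step_interval k i) = (if i \<in> I then 1 / real k else 0)" for I i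
    using S_int measure_step_interval[OF k, of i] by simp
  have S_sets: "S I \<in> sets borel" "S I \<subseteq> {0..1}" if "I \<subseteq> {1..k}" for I
  proof -
    show "S I \<in> sets borel" unfolding S_def
      by (intro sets.finite_UN finite_subset[OF that]) auto
    show "S I \<subseteq> {0..1}" unfolding S_def using step_interval_unit[OF k] that by blast
  qed
  have "(LINT z:S I \<times> S J|lebesgue. ?V f z) = (LINT z:S I \<times> S J|lborel. ?V f z)"
    unfolding set_lebesgue_integral_def
    by (intro integral_completion borel_measurable_scaleR borel_measurable_indicator)
       (use sampled_step_apply_measurable borel_Times[OF S_sets(1)[OF I] S_sets(1)[OF J]] in auto)
  also have "\<dots> = (\<Sum>i=1..k. \<Sum>j=1..k. (if i \<in> I then 1 / real k else 0) * (if j \<in> J then 1 / real k else 0) *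
      (if i = j then 0 else blinfun_apply (U (x i, x j)) f))"
    unfolding integral_sampled_step[OF k S_sets(1)[OF I] S_sets(1)[OF J]] S_meas ..
  also have "\<dots> = (\<Sum>i\<in>I. \<Sum>j\<in>J. (if i = j then 0 else blinfun_apply (U (x i, x j)) f) / (real k)\<^sup>2)"
  proof -
    let ?h = "\<lambda>i j. (if i = j then 0 else blinfun_apply (U (x i, x j)) f) / (real k)\<^sup>2"
    have "(\<Sum>i\<in>I. \<Sum>j\<in>J. ?h i j) = (\<Sum>i\<in>{1..k} \<inter> I. \<Sum>j\<in>{1..k} \<inter> J. ?h i j)"
      using I J by (simp only: Int_absorb1)
    also have "\<dots> = (\<Sum>i=1..k. if i \<in> I then \<Sum>j=1..k. if j \<in> J then ?h i j else 0 else 0)"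
      by (simp only: sum.inter_restrict finite_atLeastAtMost)
    also have "\<dots> = (\<Sum>i=1..k. \<Sum>j=1..k. (if i \<in> I then 1 / real k else 0) * (if j \<in> J then 1 / real k else 0) *
      (if i = j then 0 else blinfun_apply (U (x i, x j)) f))"
    proof (intro sum.cong refl)
      fix i
      show "(if i \<in> I then \<Sum>j=1..k. if j \<in> J then ?h i j else 0 else 0) =
        (\<Sum>j=1..k. (if i \<in> I then 1 / real k else 0) * (if j \<in> J then 1 / real k else 0) *
          (if i = j then 0 else blinfun_apply (U (x i, x j)) f))"
        by (cases "i \<in> I") (auto simp: power2_eq_square intro!: sum.cong)
    qed
    finally show ?thesis by simp
  qed
  also have "\<dots> = blinfun_apply (off_diagonal_sum U x I J) f / (real k)\<^sup>2"
    unfolding off_diagonal_sum_apply by (simp add: sum_divide_distrib)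
  finally have "\<bar>blinfun_apply (off_diagonal_sum U x I J) f\<bar> / (real k)\<^sup>2 = \<bar>LINT z:S I \<times> S J|lebesgue. ?V f z\<bar>"
    by simp
  also have "\<dots> \<le> real_cut_norm (?V f)"
    unfolding real_cut_norm_def
    using cSUP_upper[OF _ bdd_above_cut_norm_sampled_step(1)[OF k f], of "(S I, S J)"] S_sets I J by simp
  also have "\<dots> \<le> cut_norm (sampled_step k U x)"
    unfolding cut_norm_def
    by (rule cSup_upper[OF _ bdd_above_cut_norm_sampled_step(2)[OF k]]) (use f in auto)
  finally show ?thesis using k by (simp add: divide_le_eq)
qed

text \<open>Describes each sublevel set by finitely many norm conditions, which is the form needed
  for measurability. The condition \<open>c \<ge> 0\<close> reflects the 0 inserted in the cut
  norm.\<close>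

lemma cut_norm_sampled_step_le_iff:
  assumes k: "k > 0"
  shows "cut_norm (sampled_step k U x) \<le> c \<longleftrightarrow>
    c \<ge> 0 \<and> (\<forall>I J. I \<subseteq> {1..k} \<longrightarrow> J \<subseteq> {1..k} \<longrightarrow> norm (off_diagonal_sum U x I J) \<le> c * (real k)\<^sup>2)"
proof (intro iffI conjI allI impI)
  assume le: "cut_norm (sampled_step k U x) \<le> c"
  show c: "c \<ge> 0" using le cut_norm_sampled_step_nonneg[OF k, of U x] by linarith
  fix I J assume IJ: "I \<subseteq> {1..k}" "J \<subseteq> {1..k}"
  let ?w = "off_diagonal_sum U x I J"
  show "norm ?w \<le> c * (real k)\<^sup>2"
  proof (rule norm_blinfun_bound)
    fix f
    show "norm (blinfun_apply ?w f) \<le> c * (real k)\<^sup>2 * norm f"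
    proof (cases "f = 0")
      case False
      have "\<bar>blinfun_apply ?w (f /\<^sub>R norm f)\<bar> \<le> cut_norm (sampled_step k U x) * (real k)\<^sup>2"
        by (rule off_diagonal_sum_le_cut_norm[OF k _ IJ]) (use False in simp)
      also have "\<dots> \<le> c * (real k)\<^sup>2" by (intro mult_right_mono le) simp
      finally have "\<bar>blinfun_apply ?w f\<bar> / norm f \<le> c * (real k)\<^sup>2"
        by (simp add: blinfun.scaleR_right abs_mult divide_inverse mult.commute)
      then show ?thesis using False by (simp add: pos_divide_le_eq)
    qed simp
  qed (use c in simp)
next
  assume "c \<ge> 0 \<and> (\<forall>I J. I \<subseteq> {1..k} \<longrightarrow> J \<subseteq> {1..k} \<longrightarrow> norm (off_diagonal_sum U x I J) \<le> c * (real k)\<^sup>2)"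
  then show "cut_norm (sampled_step k U x) \<le> c"
    using cut_norm_sampled_step_le[OF k, of c U x] by metis
qed

section \<open>Laws of sample pairs and measurability of the cut norm\<close>

text \<open>The inequality defines a closed set of vectors \<open>f\<close>. It is homogeneous in
  \<open>f\<close> because a dense set may contain no unit vector.\<close>

lemma norm_blinfun_le_iff_dense:
  fixes w :: "'a::real_normed_vector \<Rightarrow>\<^sub>L 'b::real_normed_vector"
  assumes D: "closure D = UNIV" and c: "c \<ge> 0"
  shows "norm w \<le> c \<longleftrightarrow> (\<forall>f\<in>D. norm (blinfun_apply w f) \<le> c * norm f)"
proof
  assume "norm w \<le> c"
  then show "\<forall>f\<in>D. norm (blinfun_apply w f) \<le> c * norm f"
    using norm_blinfun[of w] by (meson mult_right_mono norm_ge_zero order_trans)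
next
  assume *: "\<forall>f\<in>D. norm (blinfun_apply w f) \<le> c * norm f"
  have "closed {f. norm (blinfun_apply w f) \<le> c * norm f}"
    by (intro closed_Collect_le continuous_intros)
  then have "closure D \<subseteq> {f. norm (blinfun_apply w f) \<le> c * norm f}"
    using * by (intro closure_minimal) auto
  then show "norm w \<le> c"
    using D c by (intro norm_blinfun_bound) auto
qed

lemma uniform_pair:
  "uniform_measure lborel {0..1::real} \<Otimes>\<^sub>M uniform_measure lborel {0..1::real}
    = density lborel (\<lambda>z. ennreal (indicator unit_square z))"
proof -
  have u: "uniform_measure lborel {0..1::real} = density lborel (indicator {0..1})"
    unfolding uniform_measure_def by (simp add: divide_ennreal_def)
  have "prob_space (uniform_measure lborel {0..1::real})"
    by (rule prob_space_uniform_measure) auto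
  then have "sigma_finite_measure (density lborel (indicator {0..1::real}))"
    unfolding u by (rule prob_space_imp_sigma_finite)
  then have "uniform_measure lborel {0..1::real} \<Otimes>\<^sub>M uniform_measure lborel {0..1::real}
    = density (lborel \<Otimes>\<^sub>M lborel) (\<lambda>(x, y). indicator {0..1} x * indicator {0..1} y)"
    unfolding u by (intro pair_measure_density) (auto intro: lborel.sigma_finite_measure_axioms)
  also have "\<dots> = density lborel (\<lambda>z. ennreal (indicator unit_square z))"
    unfolding lborel_prod by (rule arg_cong[where f = "density lborel"]) (auto simp: indicator_def fun_eq_iff)
  finally show ?thesis .
qed

context prob_space
begin

text \<open>For distinct indices the pair has the uniform law on the square, so planar null sets are
  avoided almost surely. For equal indices this fails: the pair then lies on the diagonal, itself a
  null set.\<close>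

lemma AE_uniform_pair:
  assumes X: "indep_vars (\<lambda>_. borel) X I" "\<And>i. i \<in> I \<Longrightarrow> distr M borel (X i) = uniform_measure lborel {0..1}"
    and ij: "i \<in> I" "j \<in> I" "i \<noteq> j"
    and P: "AE z in lborel. z \<in> unit_square \<longrightarrow> P z"
  shows "AE \<omega> in M. P (X i \<omega>, X j \<omega>)"
proof -
  have [measurable]: "X i \<in> borel_measurable M" "X j \<in> borel_measurable M"
    using X(1) ij by (auto simp: indep_vars_def)
  have "AE z in density lborel (\<lambda>z. ennreal (indicator unit_square z)). P z"
    by (subst AE_density) (use P unit_square_sets in \<open>auto simp: indicator_def\<close>)
  also have "density lborel (\<lambda>z. ennreal (indicator unit_square z)) = distr M (borel \<Otimes>\<^sub>M borel) (\<lambda>\<omega>. (X i \<omega>, X j \<omega>))"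
    using indep_vars_distr_pair[OF X(1) ij] X(2) ij uniform_pair by simp
  finally show ?thesis by (rule AE_distrD[rotated]) simp
qed

text \<open>
  By bilinearity the supremum over \<open>S\<close> and \<open>T\<close> is attained at unions of steps, so the cut norm is a
  finite maximum of dual norms; separability makes each of these a countable supremum.
\<close>

lemma cut_norm_sampled_step_measurable:
  fixes U :: "real \<times> real \<Rightarrow> ('z::real_normed_vector \<Rightarrow>\<^sub>L real)"
  assumes sep: "separable_space (euclidean :: 'z topology)" and k: "k > 0"
    and U: "weak_star_measurable U"
    and X: "indep_vars (\<lambda>_. borel) X {1..k}"
      "\<And>i. i \<in> {1..k} \<Longrightarrow> distr M borel (X i) = uniform_measure lborel {0..1}"
  shows "(\<lambda>\<omega>. cut_norm (sampled_step k U (\<lambda>i. X i \<omega>))) \<in> borel_measurable (completion M)"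
proof -
  obtain D :: "'z set" where D: "countable D" "closure D = UNIV"
    using sep by (auto simp: separable_space_def)
  have apply_meas [measurable]: "(\<lambda>\<omega>. blinfun_apply (U (X i \<omega>, X j \<omega>)) f) \<in> borel_measurable (completion M)"
    if ij: "i \<in> {1..k}" "j \<in> {1..k}" "i \<noteq> j" for i j f
  proof -
    have sq: "unit_square \<in> sets lebesgue" using unit_square_sets by simp
    have "(\<lambda>z. blinfun_apply (U z) f) \<in> borel_measurable (lebesgue_on unit_square)"
      using U by (simp add: weak_star_measurable_def)
    then obtain g where g: "g \<in> borel_measurable borel" "AE z in lborel. z \<in> unit_square \<longrightarrow> blinfun_apply (U z) f = g z"
      by (rule lebesgue_on_ex_borel_measurable[OF sq])
    have [measurable]: "X i \<in> borel_measurable M" "X j \<in> borel_measurable M"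
      using X(1) ij by (auto simp: indep_vars_def)
    \<comment> \<open>The Borel representative gives an \<open>M\<close>-measurable function; the
      pairing with \<open>U\<close> agrees with it almost surely and is thus measurable for the
      completion.\<close>
    have "(\<lambda>\<omega>. g (X i \<omega>, X j \<omega>)) \<in> borel_measurable M"
      by (rule measurable_compose[OF _ g(1)]) simp
    then show ?thesis
      by (rule borel_measurable_completion_AE[OF _ AE_uniform_pair[OF X ij g(2)]])
  qed
  have sum_meas: "(\<lambda>\<omega>. blinfun_apply (off_diagonal_sum U (\<lambda>i. X i \<omega>) I J) f) \<in> borel_measurable (completion M)"
    if "I \<subseteq> {1..k}" "J \<subseteq> {1..k}" for I J f
    unfolding off_diagonal_sum_apply
  proof (intro borel_measurable_sum)
    fix i j assume "i \<in> I" "j \<in> J"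
    then have ij: "i \<in> {1..k}" "j \<in> {1..k}" using that by auto
    show "(\<lambda>\<omega>. if i = j then 0 else blinfun_apply (U (X i \<omega>, X j \<omega>)) f) \<in> borel_measurable (completion M)"
      using apply_meas[OF ij, of f] by (cases "i = j") simp_all
  qed
  show ?thesis
  proof (rule borel_measurableI_le)
    fix c :: real
    let ?F = "{(I, J, f). I \<subseteq> {1..k} \<and> J \<subseteq> {1..k} \<and> f \<in> D}"
    have "countable (Pow {1..k} \<times> Pow {1..k} \<times> D)"
      by (intro countable_SIGMA D(1)) (auto intro: countable_finite)
    then have F: "countable ?F" by (rule countable_subset[rotated]) auto
    have eq: "cut_norm (sampled_step k U x) \<le> c \<longleftrightarrow>
      c \<ge> 0 \<and> (\<forall>(I, J, f)\<in>?F. \<bar>blinfun_apply (off_diagonal_sum U x I J) f\<bar> \<le> c * (real k)\<^sup>2 * norm f)" for x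
      unfolding cut_norm_sampled_step_le_iff[OF k]
    proof (rule conj_cong[OF refl])
      assume "c \<ge> 0"
      then have "norm w \<le> c * (real k)\<^sup>2 \<longleftrightarrow> (\<forall>f\<in>D. \<bar>blinfun_apply w f\<bar> \<le> c * (real k)\<^sup>2 * norm f)" for w
        by (simp add: norm_blinfun_le_iff_dense[OF D(2)])
      then show "(\<forall>I J. I \<subseteq> {1..k} \<longrightarrow> J \<subseteq> {1..k} \<longrightarrow> norm (off_diagonal_sum U x I J) \<le> c * (real k)\<^sup>2) \<longleftrightarrow>
        (\<forall>(I, J, f)\<in>?F. \<bar>blinfun_apply (off_diagonal_sum U x I J) f\<bar> \<le> c * (real k)\<^sup>2 * norm f)"
        by (simp only:) blast
    qed
    have "{\<omega> \<in> space (completion M). \<forall>p\<in>?F. (case p of (I, J, f) \<Rightarrow> \<bar>blinfun_apply (off_diagonal_sum U (\<lambda>i. X i \<omega>) I J) f\<bar> \<le> c * (real k)\<^sup>2 * norm f)}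
      \<in> sets (completion M)"
    proof (rule sets.sets_Collect_countable_All'[OF _ F], clarify)
      fix I J f assume "I \<subseteq> {1..k}" "J \<subseteq> {1..k}"
      note [measurable] = sum_meas[OF this]
      show "{\<omega> \<in> space (completion M). \<bar>blinfun_apply (off_diagonal_sum U (\<lambda>i. X i \<omega>) I J) f\<bar> \<le> c * (real k)\<^sup>2 * norm f}
        \<in> sets (completion M)" by measurable
    qed
    then show "{\<omega> \<in> space (completion M). cut_norm (sampled_step k U (\<lambda>i. X i \<omega>)) \<le> c} \<in> sets (completion M)"
      unfolding eq by (cases "c \<ge> 0") auto
  qed
qed

end

subsection \<open>The cut norm of an \<open>L\<^sup>p\<close>-kernel\<close>

text \<open>The square has finite measure, and t \<le> 1 + t^p for t \<ge> 0 and p \<ge> 1.\<close>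

lemma Lp_kernel_integrable_norm:
  assumes U: "Lp_kernel p U" and p: "p \<ge> 1"
  shows "integrable (lebesgue_on unit_square) (\<lambda>z. norm (U z))"
proof (rule Bochner_Integration.integrable_bound)
  have "finite_measure (lebesgue_on unit_square)"
  proof
    have "emeasure (lborel \<Otimes>\<^sub>M lborel) unit_square = emeasure lborel {0..1::real} * emeasure lborel {0..1::real}"
      by (rule lborel.emeasure_pair_measure_Times) auto
    then show "emeasure (lebesgue_on unit_square) (space (lebesgue_on unit_square)) \<noteq> \<infinity>"
      using unit_square_sets by (simp add: emeasure_restrict_space lborel_prod)
  qed
  then show "integrable (lebesgue_on unit_square) (\<lambda>z. 1 + norm (U z) powr p)"
    using U unfolding Lp_kernel_def
    by (intro Bochner_Integration.integrable_add finite_measure.integrable_const) auto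
  have "norm (U z) \<le> 1 + norm (U z) powr p" for z
  proof (cases "norm (U z) \<le> 1")
    case False
    then have "norm (U z) powr 1 \<le> norm (U z) powr p" using p by (intro powr_mono) auto
    then show ?thesis by simp
  qed (simp add: add_increasing2)
  then show "AE z in lebesgue_on unit_square. norm (norm (U z)) \<le> norm (1 + norm (U z) powr p)"
    by (intro AE_I2) simp
qed (use U in \<open>simp add: Lp_kernel_def\<close>)

lemma Lr_norm_nonneg: "Lr_norm r U \<ge> 0"
  by (simp add: Lr_norm_def)

lemma Lr_norm_1: "Lr_norm 1 U = (LINT z|lebesgue_on unit_square. norm (U z))"
  by (simp add: Lr_norm_def)

lemma Lr_norm_powr: "r > 0 \<Longrightarrow> Lr_norm r U powr r = (LINT z|lebesgue_on unit_square. norm (U z) powr r)"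
  by (simp add: Lr_norm_def powr_powr)

lemma abs_integral_pairing_le:
  assumes U: "integrable (lebesgue_on unit_square) (\<lambda>z. norm (U z))" and f: "norm f = 1"
    and "S \<subseteq> {0..1}" "T \<subseteq> {0..1}"
  shows "\<bar>LINT z:S \<times> T|lebesgue. blinfun_apply (U z) f\<bar> \<le> Lr_norm 1 U"
proof -
  have sq: "unit_square \<inter> space lebesgue \<in> sets lebesgue" using unit_square_sets by simp
  have "\<bar>LINT z:S \<times> T|lebesgue. blinfun_apply (U z) f\<bar>
      \<le> (\<integral>z. norm (indicator (S \<times> T) z *\<^sub>R blinfun_apply (U z) f) \<partial>lebesgue)"
    unfolding set_lebesgue_integral_def using integral_norm_bound[of lebesgue "\<lambda>z. indicator (S \<times> T) z *\<^sub>R blinfun_apply (U z) f"] by simp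
  also have "\<dots> \<le> (\<integral>z. indicator unit_square z *\<^sub>R norm (U z) \<partial>lebesgue)"
  \<comment> \<open>This comparison asks integrability only of the nonnegative majorant, so the
    pairing itself need not be shown integrable.\<close>
  proof (rule integral_mono')
    show "integrable lebesgue (\<lambda>z. indicator unit_square z *\<^sub>R norm (U z))"
      using U by (subst (asm) integrable_restrict_space[OF sq])
    fix z
    have "norm (blinfun_apply (U z) f) \<le> norm (U z)" using norm_blinfun[of "U z" f] f by simp
    then show "norm (indicator (S \<times> T) z *\<^sub>R blinfun_apply (U z) f) \<le> indicator unit_square z *\<^sub>R norm (U z)"
      using assms(3,4) by (cases z) (auto simp: indicator_def)
  qed simp
  also have "\<dots> = Lr_norm 1 U" unfolding Lr_norm_1 by (rule integral_restrict_space[OF sq, symmetric])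
  finally show ?thesis .
qed

text \<open>The L^1 bound is uniform over unit vectors. It also makes the set in the cut norm
  bounded above, and only then does its member 0 give nonnegativity.\<close>

lemma cut_norm_Lr_norm:
  assumes U: "integrable (lebesgue_on unit_square) (\<lambda>z. norm (U z))"
  shows cut_norm_le_L1: "cut_norm U \<le> Lr_norm 1 U" and cut_norm_nonneg: "0 \<le> cut_norm U"
proof -
  have le: "real_cut_norm (\<lambda>z. blinfun_apply (U z) f) \<le> Lr_norm 1 U" if "norm f = 1" for f
    by (rule real_cut_norm_le) (rule abs_integral_pairing_le[OF U that])
  then show "cut_norm U \<le> Lr_norm 1 U"
    unfolding cut_norm_def by (intro cSup_least insert_not_empty) (use Lr_norm_nonneg in blast)
  have "bdd_above (insert 0 ((\<lambda>f. real_cut_norm (\<lambda>z. blinfun_apply (U z) f)) ` {f. norm f = 1}))"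
    unfolding bdd_above_insert by (rule bdd_aboveI2[where M = "Lr_norm 1 U"]) (simp add: le)
  then show "0 \<le> cut_norm U" unfolding cut_norm_def by (rule cSup_upper[OF insertI1])
qed

text \<open>Since \<open>c \<ge> 0\<close>, the element exceeding \<open>c\<close> is not the
  inserted 0 and so comes from a unit vector.\<close>

lemma less_cut_normE:
  assumes "c < cut_norm U" "c \<ge> 0"
  obtains f S T where "norm f = 1" "S \<in> sets lebesgue" "S \<subseteq> {0..1}" "T \<in> sets lebesgue" "T \<subseteq> {0..1}"
    "c < \<bar>LINT z:S \<times> T|lebesgue. blinfun_apply (U z) f\<bar>"
proof -
  let ?A = "{(S, T). S \<in> sets lebesgue \<and> S \<subseteq> {0..1::real} \<and> T \<in> sets lebesgue \<and> T \<subseteq> {0..1::real}}"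
  obtain y where "y \<in> insert 0 ((\<lambda>f. real_cut_norm (\<lambda>z. blinfun_apply (U z) f)) ` {f. norm f = 1})" "c < y"
    using less_cSupD[OF _ assms(1)[unfolded cut_norm_def]] by blast
  then obtain f where f: "norm f = 1" "c < real_cut_norm (\<lambda>z. blinfun_apply (U z) f)"
    using assms(2) by auto
  have "({}, {}) \<in> ?A" by simp
  then have "(\<lambda>(S, T). \<bar>LINT z:S \<times> T|lebesgue. blinfun_apply (U z) f\<bar>) ` ?A \<noteq> {}" by blast
  from less_cSupD[OF this f(2)[unfolded real_cut_norm_def]]
  obtain y where y: "y \<in> (\<lambda>(S, T). \<bar>LINT z:S \<times> T|lebesgue. blinfun_apply (U z) f\<bar>) ` ?A" "c < y"
    by (rule bexE)
  from y(1) obtain p where "y = (case p of (S, T) \<Rightarrow> \<bar>LINT z:S \<times> T|lebesgue. blinfun_apply (U z) f\<bar>)" "p \<in> ?A"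
    by (rule imageE)
  note p = this y(2)
  show thesis
    by (rule that[of f "fst p" "snd p"]) (use f p in \<open>simp_all add: case_prod_unfold\<close>)
qed

text \<open>Supplies the positive truncation level. If the p-norm vanished, \<open>U\<close> would
  be zero almost everywhere, and the cut norm is at most the 1-norm.\<close>

lemma Lr_norm_pos:
  assumes U: "Lp_kernel p U" and p: "p \<ge> 1" and cut: "cut_norm U > 0"
  shows "Lr_norm p U > 0"
proof (rule ccontr)
  assume "\<not> Lr_norm p U > 0"
  then have "Lr_norm p U = 0" using Lr_norm_nonneg[of p U] by simp
  then have "(LINT z|lebesgue_on unit_square. norm (U z) powr p) = 0"
    using Lr_norm_powr[of p U] p by simp
  then have "AE z in lebesgue_on unit_square. norm (U z) powr p = 0"
    using U by (subst (asm) integral_nonneg_eq_0_iff_AE) (auto simp: Lp_kernel_def)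
  then have "AE z in lebesgue_on unit_square. norm (U z) = 0" by eventually_elim simp
  then have "Lr_norm 1 U = 0" unfolding Lr_norm_1 by (rule integral_eq_zero_AE)
  then show False using cut_norm_le_L1[OF Lp_kernel_integrable_norm[OF U p]] cut by simp
qed

lemma integral_uniform_pair:
  fixes H :: "real \<times> real \<Rightarrow> real"
  assumes [measurable]: "H \<in> borel_measurable borel"
  shows "(\<integral>z. H z \<partial>(uniform_measure lborel {0..1} \<Otimes>\<^sub>M uniform_measure lborel {0..1}))
      = (\<integral>z. indicator unit_square z *\<^sub>R H z \<partial>lborel)"
    and "integrable (uniform_measure lborel {0..1} \<Otimes>\<^sub>M uniform_measure lborel {0..1}) H
      \<longleftrightarrow> integrable lborel (\<lambda>z. indicator unit_square z *\<^sub>R H z)"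
  unfolding uniform_pair using unit_square_sets
  by (subst integral_density integrable_density; simp)+

subsection \<open>Concentration\<close>

context prob_space
begin

text \<open>The probabilistic content for one choice of \<open>f\<close>, \<open>S\<close>,
  \<open>T\<close>. The threshold \<open>\<theta>\<close> is left free, so that the comparison of
  constants is a separate question about real numbers.\<close>

lemma cut_norm_sampled_step_lower_tail:
  fixes U :: "real \<times> real \<Rightarrow> ('z::real_normed_vector \<Rightarrow>\<^sub>L real)"
  assumes sep: "separable_space (euclidean :: 'z topology)" and k: "k \<ge> 2"
    and U: "Lp_kernel p U" and p: "p \<ge> 1" "\<gamma> * p > 1" and C: "Lr_norm p U > 0"
    and X: "indep_vars (\<lambda>_. borel) X {1..k}"
      "\<And>i. i \<in> {1..k} \<Longrightarrow> distr M borel (X i) = uniform_measure lborel {0..1}"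
    and f: "norm f = 1" and S: "S \<in> sets lebesgue" "S \<subseteq> {0..1}" and T: "T \<in> sets lebesgue" "T \<subseteq> {0..1}"
    and \<theta>: "\<theta> * (real k)\<^sup>2 \<le> real k * (real k - 1) * \<bar>LINT z:S \<times> T|lebesgue. blinfun_apply (U z) f\<bar>
        - (2 * real k powr (1 + \<gamma>) + 2 * sqrt (2 * ((\<gamma> * p - 1) * ln (real k))) * real k powr (3 / 2 + \<gamma>)) * Lr_norm p U"
  shows "measure (completion M) {\<omega> \<in> space M. cut_norm (sampled_step k U (\<lambda>i. X i \<omega>)) \<ge> \<theta>}
    \<ge> 1 - 2 * real k powr (1 - \<gamma> * p)"
proof -
  let ?\<mu> = "uniform_measure lborel {0..1::real}"
  let ?K = "off_diagonal {1..k}"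
  define m where "m = (LINT z:S \<times> T|lebesgue. blinfun_apply (U z) f)"
  \<comment> \<open>The sign of the integral, chosen once and independently of the sample, turns the
    mean of \<open>H\<close> into \<open>\<bar>m\<bar>\<close>.\<close>
  define \<sigma> :: real where "\<sigma> = (if m \<ge> 0 then 1 else - 1)"
  have sq: "unit_square \<in> sets lebesgue" "unit_square \<inter> space lebesgue \<in> sets lebesgue"
    using unit_square_sets by simp_all
  have "(\<lambda>z. blinfun_apply (U z) f) \<in> borel_measurable (lebesgue_on unit_square)"
    using U by (simp add: Lp_kernel_def weak_star_measurable_def)
  then obtain g where g: "g \<in> borel_measurable borel" "AE z in lborel. z \<in> unit_square \<longrightarrow> blinfun_apply (U z) f = g z"
    by (rule lebesgue_on_ex_borel_measurable[OF sq(1)])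
  obtain S' T' where ST: "S' \<in> sets borel" "S' \<subseteq> S" "T' \<in> sets borel" "T' \<subseteq> T"
    and eq: "\<And>V g :: real \<times> real \<Rightarrow> real. g \<in> borel_measurable borel \<Longrightarrow>
      AE z in lborel. z \<in> unit_square \<longrightarrow> V z = g z \<Longrightarrow>
      (LINT z:S \<times> T|lebesgue. V z) = (LINT z:S' \<times> T'|lborel. g z)"
    by (rule set_integral_Times_borel[OF S T]) (rule that)
  have m: "m = (\<integral>z. indicator (S' \<times> T') z *\<^sub>R g z \<partial>lborel)"
    using eq[OF g] unfolding m_def by (simp add: set_lebesgue_integral_def)
  define H where "H z = \<sigma> * (indicator (S' \<times> T') z * g z)" for z
  have H [measurable]: "H \<in> borel_measurable borel"
    using g(1) borel_Times[OF ST(1,3)] unfolding H_def by measurable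
  have "(\<integral>z. H z \<partial>(?\<mu> \<Otimes>\<^sub>M ?\<mu>)) = (\<integral>z. \<sigma> * (indicator (S' \<times> T') z *\<^sub>R g z) \<partial>lborel)"
    unfolding integral_uniform_pair(1)[OF H]
    by (intro Bochner_Integration.integral_cong refl) (use ST S T in \<open>auto simp: H_def indicator_def\<close>)
  also have "\<dots> = \<bar>m\<bar>" unfolding m by (simp add: \<sigma>_def m)
  finally have mean: "(\<integral>z. H z \<partial>(?\<mu> \<Otimes>\<^sub>M ?\<mu>)) = \<bar>m\<bar>" .
  let ?h = "\<lambda>z. indicator unit_square z *\<^sub>R \<bar>H z\<bar> powr p" and ?u = "\<lambda>z. indicator unit_square z *\<^sub>R norm (U z) powr p"
  \<comment> \<open>As \<open>f\<close> is a unit vector, |H| is at most the norm of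
    \<open>U\<close> almost everywhere on the square. The p-th moment of \<open>H\<close> is thus
    controlled by the p-norm of \<open>U\<close>.\<close>
  have hu: "AE z in lebesgue. norm (?h z) \<le> norm (?u z)"
  proof (rule AE_completion, use g(2) in eventually_elim)
    fix z assume z: "z \<in> unit_square \<longrightarrow> blinfun_apply (U z) f = g z"
    have "\<bar>H z\<bar> \<le> \<bar>g z\<bar>" by (auto simp: H_def \<sigma>_def indicator_def)
    moreover have "\<bar>blinfun_apply (U z) f\<bar> \<le> norm (U z)" using norm_blinfun[of "U z" f] f by simp
    ultimately have "z \<in> unit_square \<Longrightarrow> \<bar>H z\<bar> powr p \<le> norm (U z) powr p"
      using z p by (intro powr_mono2) auto
    then show "norm (?h z) \<le> norm (?u z)" by (cases "z \<in> unit_square") simp_all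
  qed
  have h_borel: "?h \<in> borel_measurable lborel" using unit_square_sets by simp
  have u_int: "integrable lebesgue ?u"
    using U unfolding Lp_kernel_def integrable_restrict_space[OF sq(2)] by blast
  have h_int: "integrable lebesgue ?h"
    by (rule Bochner_Integration.integrable_bound[OF u_int _ hu]) (use h_borel in \<open>rule measurable_completion\<close>)
  have Hp: "integrable (?\<mu> \<Otimes>\<^sub>M ?\<mu>) (\<lambda>z. \<bar>H z\<bar> powr p)"
    using h_int h_borel by (subst integral_uniform_pair(2)) (simp_all add: integrable_completion)
  have "(\<integral>z. \<bar>H z\<bar> powr p \<partial>(?\<mu> \<Otimes>\<^sub>M ?\<mu>)) = integral\<^sup>L lebesgue ?h"
    unfolding integral_completion[OF h_borel] by (rule integral_uniform_pair(1)) simp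
  also have "\<dots> \<le> integral\<^sup>L lebesgue ?u"
    by (rule integral_mono_AE[OF h_int u_int]) (use hu in simp)
  also have "\<dots> = Lr_norm p U powr p"
    using p by (simp only: Lr_norm_powr integral_restrict_space[OF sq(2)])
  finally have Hp': "(\<integral>z. \<bar>H z\<bar> powr p \<partial>(?\<mu> \<Otimes>\<^sub>M ?\<mu>)) \<le> Lr_norm p U powr p" .
  define Q where "Q \<omega> = (\<Sum>(i, j)\<in>?K. H (X i \<omega>, X j \<omega>))" for \<omega>
  define F where "F \<omega> = cut_norm (sampled_step k U (\<lambda>i. X i \<omega>))" for \<omega>
  have rv [measurable]: "X i \<in> borel_measurable M" if "i \<in> {1..k}" for i
    using X(1) that by (auto simp: indep_vars_def)
  have Q_meas [measurable]: "Q \<in> borel_measurable M"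
    unfolding Q_def case_prod_unfold
    by (intro borel_measurable_sum measurable_compose[OF _ H] borel_measurable_Pair rv) auto
  have F_meas: "F \<in> borel_measurable (completion M)"
    unfolding F_def by (rule cut_norm_sampled_step_measurable[OF sep _ _ X]) (use k U in \<open>auto simp: Lp_kernel_def\<close>)
  have H': "H \<in> borel_measurable (borel \<Otimes>\<^sub>M borel)" unfolding borel_prod by (rule H)
  have "prob {\<omega> \<in> space M. Q \<omega> < \<theta> * (real k)\<^sup>2}
    \<le> prob {\<omega> \<in> space M. Q \<omega> < real (card {1..k}) * (real (card {1..k}) - 1) * (\<integral>z. H z \<partial>(?\<mu> \<Otimes>\<^sub>M ?\<mu>))
        - (2 * real (card {1..k}) powr (1 + \<gamma>) + 2 * sqrt (2 * ((\<gamma> * p - 1) * ln (real (card {1..k})))) * real (card {1..k}) powr (3 / 2 + \<gamma>)) * Lr_norm p U}"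
    using \<theta> unfolding mean m_def by (intro finite_measure_mono) auto
  also have "\<dots> \<le> 2 * real (card {1..k}) powr (1 - \<gamma> * p)"
    unfolding Q_def by (rule U_statistic_lower_tail[OF X _ _ H' Hp Hp' C p]) (use k in auto)
  finally have tail: "prob {\<omega> \<in> space M. Q \<omega> < \<theta> * (real k)\<^sup>2} \<le> 2 * real k powr (1 - \<gamma> * p)" by simp
  \<comment> \<open>Only finitely many pairs occur, so one almost sure event serves all of them; on
    it \<open>g\<close> may be replaced by the pairing with \<open>U\<close>.\<close>
  have "AE \<omega> in M. \<forall>(i, j)\<in>?K. blinfun_apply (U (X i \<omega>, X j \<omega>)) f = g (X i \<omega>, X j \<omega>)"
  proof (rule AE_finite_allI[OF finite_off_diagonal], simp)
    fix ij assume "ij \<in> ?K"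
    then obtain i j where ij: "ij = (i, j)" "i \<in> {1..k}" "j \<in> {1..k}" "i \<noteq> j" by auto
    show "AE \<omega> in M. case ij of (i, j) \<Rightarrow> blinfun_apply (U (X i \<omega>, X j \<omega>)) f = g (X i \<omega>, X j \<omega>)"
      unfolding ij(1) prod.case by (rule AE_uniform_pair[OF X ij(2-4) g(2)])
  qed
  then have "AE \<omega> in M. Q \<omega> \<le> F \<omega> * (real k)\<^sup>2"
  proof eventually_elim
    case (elim \<omega>)
    \<comment> \<open>These index sets depend on the sample, but the cut norm dominates the
      off-diagonal sum for every choice of index sets.\<close>
    let ?I = "{1..k} \<inter> {i. X i \<omega> \<in> S'}" and ?J = "{1..k} \<inter> {j. X j \<omega> \<in> T'}"
    have "Q \<omega> = (\<Sum>(i, j)\<in>?K. \<sigma> * (indicator (S' \<times> T') (X i \<omega>, X j \<omega>) * blinfun_apply (U (X i \<omega>, X j \<omega>)) f))"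
      unfolding Q_def H_def by (intro sum.cong refl) (use elim in auto)
    also have "\<dots> = (\<Sum>i=1..k. \<Sum>j=1..k. if i = j then 0 else
        \<sigma> * (indicator (S' \<times> T') (X i \<omega>, X j \<omega>) * blinfun_apply (U (X i \<omega>, X j \<omega>)) f))"
      by (rule sum_off_diagonal) simp
    also have "\<dots> = (\<Sum>i=1..k. if i \<in> {i. X i \<omega> \<in> S'} then \<Sum>j=1..k. if j \<in> {j. X j \<omega> \<in> T'} then
        \<sigma> * (if i = j then 0 else blinfun_apply (U (X i \<omega>, X j \<omega>)) f) else 0 else 0)"
      by (intro sum.cong refl) (auto simp: indicator_def intro!: sum.neutral sum.cong)
    also have "\<dots> = \<sigma> * blinfun_apply (off_diagonal_sum U (\<lambda>i. X i \<omega>) ?I ?J) f"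
      unfolding off_diagonal_sum_apply sum_distrib_left
      by (simp only: sum.inter_restrict finite_atLeastAtMost)
    also have "\<dots> \<le> \<bar>blinfun_apply (off_diagonal_sum U (\<lambda>i. X i \<omega>) ?I ?J) f\<bar>"
      by (auto simp: \<sigma>_def)
    also have "\<dots> \<le> F \<omega> * (real k)\<^sup>2"
      unfolding F_def by (rule off_diagonal_sum_le_cut_norm[OF _ f]) (use k in auto)
    finally show ?case .
  qed
  then have QF: "AE \<omega> in completion M. Q \<omega> \<ge> \<theta> * (real k)\<^sup>2 \<longrightarrow> F \<omega> \<ge> \<theta>"
  proof (rule AE_completion[THEN AE_mp, OF _ AE_I2])
    fix \<omega>
    show "Q \<omega> \<le> F \<omega> * (real k)\<^sup>2 \<longrightarrow> \<theta> * (real k)\<^sup>2 \<le> Q \<omega> \<longrightarrow> \<theta> \<le> F \<omega>"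
    proof (intro impI)
      assume "Q \<omega> \<le> F \<omega> * (real k)\<^sup>2" "\<theta> * (real k)\<^sup>2 \<le> Q \<omega>"
      then have "\<theta> * (real k)\<^sup>2 \<le> F \<omega> * (real k)\<^sup>2" by linarith
      then show "\<theta> \<le> F \<omega>" using k by simp
    qed
  qed
  have "prob (space M - {\<omega> \<in> space M. Q \<omega> < \<theta> * (real k)\<^sup>2}) = 1 - prob {\<omega> \<in> space M. Q \<omega> < \<theta> * (real k)\<^sup>2}"
    by (rule prob_compl) measurable
  moreover have "space M - {\<omega> \<in> space M. Q \<omega> < \<theta> * (real k)\<^sup>2} = {\<omega> \<in> space M. Q \<omega> \<ge> \<theta> * (real k)\<^sup>2}"
    by auto
  ultimately have "1 - 2 * real k powr (1 - \<gamma> * p) \<le> prob {\<omega> \<in> space M. Q \<omega> \<ge> \<theta> * (real k)\<^sup>2}"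
    using tail by simp
  also have "\<dots> = measure (completion M) {\<omega> \<in> space M. Q \<omega> \<ge> \<theta> * (real k)\<^sup>2}"
    by (rule measure_completion[symmetric]) measurable
  also have "\<dots> \<le> measure (completion M) {\<omega> \<in> space M. F \<omega> \<ge> \<theta>}"
  \<comment> \<open>Monotonicity needs the larger event to be measurable, since a non-measurable set
    is given measure 0. This is the use of the measurability of \<open>F\<close>.\<close>
  proof (rule finite_measure.finite_measure_mono_AE)
    show "finite_measure (completion M)" by (intro finite_measureI) (simp add: emeasure_space_1)
    show "{\<omega> \<in> space M. F \<omega> \<ge> \<theta>} \<in> sets (completion M)"
      using borel_measurable_le[OF borel_measurable_const F_meas, of \<theta>] by simp
  qed (use QF in auto)
  finally show ?thesis unfolding F_def .
qed

end

section \<open>Comparison of the error terms and conclusion\<close>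

text \<open>Here \<open>w\<close> is the cut norm, \<open>A\<close> and \<open>C\<close> are the
  1-norm and the p-norm, and \<open>v\<close> is the nearly maximal integral. Every loss is measured
  in the unit \<open>K^2 * q * r\<close>: the losses amount to at most 2 A + 4 C, against 6 A + 12 C
  available.\<close>

lemma deviation_bound:
  fixes k :: nat and \<gamma> p v w C A :: real
  assumes k: "k \<ge> 2" and \<gamma>: "\<gamma> > 0" and C: "C \<ge> 0" and w: "0 \<le> w" "w \<le> A"
    and v: "v \<ge> (1 - 1 / real k) * w" and L: "(\<gamma> * p - 1) * ln (real k) \<ge> 1 / 2" and p: "\<gamma> * p > 1"
  shows "(w - (w + 6 * sqrt (2 * (\<gamma> * p - 1)) * (A + 2 * C)) * real k powr (- 1 / 2 + \<gamma>) * sqrt (ln (real k))) * (real k)\<^sup>2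
    \<le> real k * (real k - 1) * v
      - (2 * real k powr (1 + \<gamma>) + 2 * sqrt (2 * ((\<gamma> * p - 1) * ln (real k))) * real k powr (3 / 2 + \<gamma>)) * C"
proof -
  define K where "K = real k"
  define r where "r = sqrt (2 * ((\<gamma> * p - 1) * ln K))"
  define q where "q = K powr (- 1 / 2 + \<gamma>)"
  have K: "K \<ge> 2" using k by (simp add: K_def)
  \<comment> \<open>The sole use of the lower bound on the logarithmic term: multiplying by
    \<open>r\<close> does not decrease the terms that lack it.\<close>
  have r: "r \<ge> 1" unfolding r_def K_def by (rule real_le_rsqrt) (use L in simp)
  have r_eq: "sqrt (2 * (\<gamma> * p - 1)) * sqrt (ln K) = r"
    unfolding r_def by (simp add: real_sqrt_mult[symmetric] mult.assoc)
  have q: "q > 0" using K by (simp add: q_def)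
  have pow1: "K powr (3 / 2 + \<gamma>) = K\<^sup>2 * q"
    using K unfolding q_def by (simp add: powr_add[symmetric] flip: powr_numeral)
  have "K powr (1 + \<gamma>) \<le> K powr (3 / 2 + \<gamma>)" using K by (intro powr_mono) auto
  also have "\<dots> \<le> K\<^sup>2 * q * r" unfolding pow1 using r K q by simp
  finally have pow2: "K powr (1 + \<gamma>) \<le> K\<^sup>2 * q * r" .
  have "K powr 0 \<le> K powr (1 / 2 + \<gamma>)" using K \<gamma> by (intro powr_mono) auto
  also have "\<dots> = K * q" using K unfolding q_def by (simp add: powr_mult_base)
  finally have "1 \<le> K * q" using K by simp
  then have "K \<le> K\<^sup>2 * q" using K by (simp add: power2_eq_square)
  also have "\<dots> \<le> K\<^sup>2 * q * r" using r K q by simp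
  finally have Kqr: "K \<le> K\<^sup>2 * q * r" .
  \<comment> \<open>The product is (K - 1)^2 w. One loss of K w comes from the diagonal, the other
    from the slack 1/K in \<open>v\<close>.\<close>
  have "K * (K - 1) * v \<ge> K * (K - 1) * ((1 - 1 / K) * w)"
    using v K by (intro mult_left_mono) (auto simp: K_def)
  also have "K * (K - 1) * ((1 - 1 / K) * w) = K\<^sup>2 * w - 2 * K * w + w"
    using K by (simp add: field_simps power2_eq_square)
  finally have 1: "K * (K - 1) * v \<ge> K\<^sup>2 * w - 2 * K * w" using w by linarith
  have "K * w \<le> (K\<^sup>2 * q * r) * A" using Kqr w K by (intro mult_mono) auto
  moreover have "0 \<le> (K\<^sup>2 * q * r) * A" using K q r w by simp
  moreover have "K powr (1 + \<gamma>) * C \<le> (K\<^sup>2 * q * r) * C" by (rule mult_right_mono[OF pow2 C])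
  moreover have "0 \<le> (K\<^sup>2 * q * r) * C" using K q r C by simp
  moreover have "0 \<le> w * q * sqrt (ln K) * K\<^sup>2" using w q K by simp
  moreover have "(w - (w + 6 * sqrt (2 * (\<gamma> * p - 1)) * (A + 2 * C)) * q * sqrt (ln K)) * K\<^sup>2
      = K\<^sup>2 * w - w * q * sqrt (ln K) * K\<^sup>2 - 6 * ((K\<^sup>2 * q * r) * A) - 12 * ((K\<^sup>2 * q * r) * C)"
    unfolding r_eq[symmetric] by (simp add: algebra_simps)
  moreover have "(2 * K powr (1 + \<gamma>) + 2 * r * K powr (3 / 2 + \<gamma>)) * C
      = 2 * (K powr (1 + \<gamma>) * C) + 2 * ((K\<^sup>2 * q * r) * C)"
    unfolding pow1 by (simp add: algebra_simps)
  ultimately show ?thesis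
    using 1 unfolding K_def[symmetric] q_def[symmetric] r_def[symmetric] by linarith
qed

theorem theorem8p2:
  fixes U :: "real \<times> real \<Rightarrow> ('z::banach \<Rightarrow>\<^sub>L real)"
    and k :: nat and p \<gamma> :: real
    and M :: "'a measure" and X :: "nat \<Rightarrow> 'a \<Rightarrow> real"
  assumes separable: "separable_space (euclidean :: 'z topology)"
    and k: "k \<ge> 2"
    and p: "p > 2"
    and U: "Lp_kernel p U"
    and \<gamma>: "1 / p < \<gamma>" "\<gamma> < 1 / 2"
    and M: "prob_space M"
    and indep: "prob_space.indep_vars M (\<lambda>_. borel) X {1..k}"
    and uniform: "\<And>i. i \<in> {1..k} \<Longrightarrow> distr M lborel (X i) = uniform_measure lborel {0..1}"
  shows "measure (completion M)
      {\<omega> \<in> space M.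
         cut_norm (sampled_step k U (\<lambda>i. X i \<omega>)) - cut_norm U
           \<ge> - ((cut_norm U + 6 * sqrt (2 * (\<gamma> * p - 1)) * (Lr_norm 1 U + 2 * Lr_norm p U))
                * real k powr (- 1 / 2 + \<gamma>) * sqrt (ln (real k)))}
    \<ge> 1 - 4 * real k powr (1 - \<gamma> * p)"
proof -
  interpret prob_space M by (rule M)
  have p1: "p \<ge> 1" and \<gamma>p: "\<gamma> * p > 1" using p \<gamma> by (auto simp: field_simps)
  have "0 < 1 / p" using p by simp
  then have \<gamma>0: "\<gamma> > 0" using \<gamma>(1) by linarith
  note L1 = Lp_kernel_integrable_norm[OF U p1]
  define \<theta> where "\<theta> = cut_norm U - (cut_norm U + 6 * sqrt (2 * (\<gamma> * p - 1)) * (Lr_norm 1 U + 2 * Lr_norm p U))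
    * real k powr (- 1 / 2 + \<gamma>) * sqrt (ln (real k))"
  have "1 - 4 * real k powr (1 - \<gamma> * p)
    \<le> measure (completion M) {\<omega> \<in> space M. cut_norm (sampled_step k U (\<lambda>i. X i \<omega>)) \<ge> \<theta>}"
  \<comment> \<open>If this holds, the claimed lower bound is at most 0.\<close>
  proof (cases "4 * real k powr (1 - \<gamma> * p) \<ge> 1")
    case True
    then show ?thesis using measure_nonneg[of "completion M"] by (smt (verit))
  next
    case nontrivial: False
    show ?thesis
    \<comment> \<open>With zero cut norm there may be no unit vector and no positive truncation
      level; but then \<open>\<theta> \<le> 0\<close>, and the event is the whole space.\<close>
    proof (cases "cut_norm U = 0")
      case True
      have "\<theta> \<le> 0"
        using k \<gamma>p by (simp add: \<theta>_def True Lr_norm_nonneg)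
      then have "{\<omega> \<in> space M. cut_norm (sampled_step k U (\<lambda>i. X i \<omega>)) \<ge> \<theta>} = space M"
        using cut_norm_sampled_step_nonneg[of k U] k by (auto intro: order_trans)
      then show ?thesis by (simp add: measure_completion prob_space)
    next
      case False
      then have cut: "cut_norm U > 0" using cut_norm_nonneg[OF L1] by simp
      \<comment> \<open>The supremum need not be attained. A relative slack of 1/k costs no more
        than the missing diagonal.\<close>
      have "(1 - 1 / real k) * cut_norm U < cut_norm U" "(1 - 1 / real k) * cut_norm U \<ge> 0"
        using cut k by (auto simp: field_simps)
      then obtain f S T where f: "norm f = 1" and S: "S \<in> sets lebesgue" "S \<subseteq> {0..1}"
        and T: "T \<in> sets lebesgue" "T \<subseteq> {0..1}"
        and v: "(1 - 1 / real k) * cut_norm U < \<bar>LINT z:S \<times> T|lebesgue. blinfun_apply (U z) f\<bar>"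
        by (rule less_cut_normE)
      have uniform': "distr M borel (X i) = uniform_measure lborel {0..1}" if "i \<in> {1..k}" for i
        unfolding uniform[OF that, symmetric] by (rule distr_cong) simp_all
      \<comment> \<open>If this failed, k^(1 - \<gamma> p) would be at least exp (-1) \<ge> 1/3,
        contrary to its being below 1/4. The value 1/2 is what makes sqrt (2 (\<gamma> p - 1) ln k)
        at least 1.\<close>
      have "(\<gamma> * p - 1) * ln (real k) \<ge> 1 / 2"
      proof (rule ccontr)
        assume "\<not> ?thesis"
        then have "- 1 \<le> (1 - \<gamma> * p) * ln (real k)" by (simp add: algebra_simps)
        then have "exp (- 1) \<le> real k powr (1 - \<gamma> * p)" using k by (simp add: powr_def)
        moreover have "exp (- 1 :: real) \<ge> 1 / 3" using exp_le by (simp add: exp_minus field_simps)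
        ultimately show False using nontrivial by simp
      qed
      then have "\<theta> * (real k)\<^sup>2 \<le> real k * (real k - 1) * \<bar>LINT z:S \<times> T|lebesgue. blinfun_apply (U z) f\<bar>
        - (2 * real k powr (1 + \<gamma>) + 2 * sqrt (2 * ((\<gamma> * p - 1) * ln (real k))) * real k powr (3 / 2 + \<gamma>)) * Lr_norm p U"
        unfolding \<theta>_def
        by (intro deviation_bound k \<gamma>0 Lr_norm_nonneg cut_norm_nonneg cut_norm_le_L1 L1 less_imp_le[OF v] \<gamma>p)
      from cut_norm_sampled_step_lower_tail[OF separable k U p1 \<gamma>p Lr_norm_pos[OF U p1 cut] indep uniform' f S T this]
      show ?thesis by (smt (verit) powr_ge_zero)
    qed
  qed
  also have "{\<omega> \<in> space M. cut_norm (sampled_step k U (\<lambda>i. X i \<omega>)) \<ge> \<theta>} = {\<omega> \<in> space M.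
         cut_norm (sampled_step k U (\<lambda>i. X i \<omega>)) - cut_norm U
           \<ge> - ((cut_norm U + 6 * sqrt (2 * (\<gamma> * p - 1)) * (Lr_norm 1 U + 2 * Lr_norm p U))
                * real k powr (- 1 / 2 + \<gamma>) * sqrt (ln (real k)))}"
    unfolding \<theta>_def by (intro Collect_cong conj_cong refl) linarith
  finally show ?thesis .
qed

end
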